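(* For any finite poset $(T,\preceq)$, $T=\{1,\dots,t\}$, the problem of classifying pairs of matrices up to simultaneous similarity contains the problem of classifying representations of $(T,\preceq)$.
   Context: Matrices are over a field $k$. A representation of the poset $(T,\preceq)$ is a block matrix $[A_1\,|\,A_2\,|\cdots|\,A_t]$ (all blocks having the same number of rows, arbitrary numbers of columns); two representations are isomorphic if one reduces to the other by (a) elementary row transformations of the whole matrix, (b) elementary column transformations within each vertical strip $A_i$, (c) additions of a column of $A_i$ to a column of $A_j$ whenever $i\prec j$. The pair problem: pairs $(M,N)$ of $n\times n$ matrices ($n$ arbitrary) up to simultaneous similarity $(M,N)\mapsto(S^{-1}MS,S^{-1}NS)$. A matrix problem $\mathcal A$ is given by a set $\mathcal A_1$ of $a$-tuples of matrices and a set of admissible transformations ("$A$ reduces to $A'$"). $\mathcal B$ contains $\mathcal A$ if there is a $b$-tuple $\mathcal T(x_1,\dots,x_a)$ of matrices whose entries are noncommutative polynomials in $x_1,\dots,x_a$ (substitution $x_i\mapsto A_i$ done blockwise, scalars $c$ becoming $cI$, $0$ becoming zero blocks) such that (i) $\mathcal T(A)\in\mathcal B_1$ for every $A\in\mathcal A_1$, and (ii) for all $A,A'\in\mathcal A_1$, $A$ reduces to $A'$ in $\mathcal A$ iff $\mathcal T(A)$ reduces to $\mathcal T(A')$ in $\mathcal B$. *)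

theory Defs
  imports "Jordan_Normal_Form.Matrix"
begin

section \<open>Elementary transformations of single matrices\<close>

definition swap_rows :: "nat \<Rightarrow> nat \<Rightarrow> 'a mat \<Rightarrow> 'a mat" where
  "swap_rows p q A = mat (dim_row A) (dim_col A)
     (\<lambda>(i,j). A $$ (if i = p then q else if i = q then p else i, j))"

definition scale_row :: "nat \<Rightarrow> 'a::field \<Rightarrow> 'a mat \<Rightarrow> 'a mat" where
  "scale_row p c A = mat (dim_row A) (dim_col A)
     (\<lambda>(i,j). if i = p then c * A $$ (i,j) else A $$ (i,j))"

text \<open>add c times row q to row p\<close>
definition add_row :: "nat \<Rightarrow> nat \<Rightarrow> 'a::field \<Rightarrow> 'a mat \<Rightarrow> 'a mat" where
  "add_row p q c A = mat (dim_row A) (dim_col A)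
     (\<lambda>(i,j). if i = p then A $$ (i,j) + c * A $$ (q,j) else A $$ (i,j))"

definition swap_cols :: "nat \<Rightarrow> nat \<Rightarrow> 'a mat \<Rightarrow> 'a mat" where
  "swap_cols p q A = mat (dim_row A) (dim_col A)
     (\<lambda>(i,j). A $$ (i, if j = p then q else if j = q then p else j))"

definition scale_col :: "nat \<Rightarrow> 'a::field \<Rightarrow> 'a mat \<Rightarrow> 'a mat" where
  "scale_col p c A = mat (dim_row A) (dim_col A)
     (\<lambda>(i,j). if j = p then c * A $$ (i,j) else A $$ (i,j))"

text \<open>add c times column q to column p\<close>
definition add_col :: "nat \<Rightarrow> nat \<Rightarrow> 'a::field \<Rightarrow> 'a mat \<Rightarrow> 'a mat" where
  "add_col p q c A = mat (dim_row A) (dim_col A)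
     (\<lambda>(i,j). if j = p then A $$ (i,j) + c * A $$ (i,q) else A $$ (i,j))"

section \<open>Matrix problems\<close>

text \<open>A matrix problem: a set of tuples (lists) of matrices together with the
  relation "reduces to".\<close>
type_synonym 'a matrix_problem = "'a mat list set \<times> ('a mat list \<Rightarrow> 'a mat list \<Rightarrow> bool)"

section \<open>Representations of a finite poset ({1..t}, R)\<close>

text \<open>A representation [A_1|...|A_t] is the list As with As ! (i - 1) = A_i;
  all blocks have the same number of rows.\<close>
definition poset_reps :: "nat \<Rightarrow> 'a mat list set" where
  "poset_reps t = {As. length As = t \<and> (\<forall>i<t. \<forall>j<t. dim_row (As!i) = dim_row (As!j))}"

text \<open>One elementary admissible transformation of a representation.\<close>
inductive poset_step :: "nat \<Rightarrow> (nat \<times> nat) set \<Rightarrow> 'a::field mat list \<Rightarrow> 'a mat list \<Rightarrow> bool"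
  for t R where
  \<comment> \<open>(a) elementary row transformations of the whole matrix\<close>
  row_swap: "As \<in> poset_reps t \<Longrightarrow> m = dim_row (As!0) \<Longrightarrow> p < m \<Longrightarrow> q < m \<Longrightarrow>
     poset_step t R As (map (swap_rows p q) As)"
| row_scale: "As \<in> poset_reps t \<Longrightarrow> m = dim_row (As!0) \<Longrightarrow> p < m \<Longrightarrow> c \<noteq> 0 \<Longrightarrow>
     poset_step t R As (map (scale_row p c) As)"
| row_add: "As \<in> poset_reps t \<Longrightarrow> m = dim_row (As!0) \<Longrightarrow> p < m \<Longrightarrow> q < m \<Longrightarrow> p \<noteq> q \<Longrightarrow>
     poset_step t R As (map (add_row p q c) As)"
  \<comment> \<open>(b) elementary column transformations within the strip A_i\<close>
| col_swap: "As \<in> poset_reps t \<Longrightarrow> i \<in> {1..t} \<Longrightarrow> p < dim_col (As!(i-1)) \<Longrightarrow>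
     q < dim_col (As!(i-1)) \<Longrightarrow>
     poset_step t R As (As[i - 1 := swap_cols p q (As!(i-1))])"
| col_scale: "As \<in> poset_reps t \<Longrightarrow> i \<in> {1..t} \<Longrightarrow> p < dim_col (As!(i-1)) \<Longrightarrow> c \<noteq> 0 \<Longrightarrow>
     poset_step t R As (As[i - 1 := scale_col p c (As!(i-1))])"
| col_add: "As \<in> poset_reps t \<Longrightarrow> i \<in> {1..t} \<Longrightarrow> p < dim_col (As!(i-1)) \<Longrightarrow>
     q < dim_col (As!(i-1)) \<Longrightarrow> p \<noteq> q \<Longrightarrow>
     poset_step t R As (As[i - 1 := add_col p q c (As!(i-1))])"
  \<comment> \<open>(c) addition of (a multiple of) column q of A_i to column p of A_j, for i \<prec> j\<close>
| strip_add: "As \<in> poset_reps t \<Longrightarrow> i \<in> {1..t} \<Longrightarrow> j \<in> {1..t} \<Longrightarrow> (i, j) \<in> R \<Longrightarrow> i \<noteq> j \<Longrightarrow>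
     q < dim_col (As!(i-1)) \<Longrightarrow> p < dim_col (As!(j-1)) \<Longrightarrow>
     poset_step t R As (As[j - 1 := mat (dim_row (As!(j-1))) (dim_col (As!(j-1)))
        (\<lambda>(r,s). if s = p then As!(j-1) $$ (r,s) + c * As!(i-1) $$ (r,q)
                  else As!(j-1) $$ (r,s))])"

definition poset_problem :: "nat \<Rightarrow> (nat \<times> nat) set \<Rightarrow> 'a::field matrix_problem" where
  "poset_problem t R = (poset_reps t, (poset_step t R)\<^sup>*\<^sup>*)"

section \<open>The pair problem\<close>

definition pair_problem :: "'a::field matrix_problem" where
  "pair_problem =
    ({[M, N] | M N n. M \<in> carrier_mat n n \<and> N \<in> carrier_mat n n},
     \<lambda>X Y. \<exists>M N M' N' n S S'. X = [M, N] \<and> Y = [M', N'] \<and>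
        M \<in> carrier_mat n n \<and> N \<in> carrier_mat n n \<and>
        S \<in> carrier_mat n n \<and> S' \<in> carrier_mat n n \<and>
        S * S' = 1\<^sub>m n \<and> S' * S = 1\<^sub>m n \<and>
        M' = S' * M * S \<and> N' = S' * N * S)"

section \<open>Noncommutative polynomials and blockwise substitution\<close>

text \<open>A noncommutative polynomial in x_1, x_2, ... is a finitely supported
  coefficient function on words; the word [i_1,...,i_k] stands for the monomial
  x_(i_1+1) ... x_(i_k+1) (variable x_(i+1) is substituted by X ! i).\<close>
type_synonym 'a ncpoly = "nat list \<Rightarrow> 'a"

definition ncpoly_supp :: "'a::zero ncpoly \<Rightarrow> nat list set" where
  "ncpoly_supp P = {w. P w \<noteq> 0}"

text \<open>word_ok X w r c: the product of the matrices named by w is defined and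
  has size r \<times> c (the empty word means the identity, requiring r = c).\<close>
fun word_ok :: "'a mat list \<Rightarrow> nat list \<Rightarrow> nat \<Rightarrow> nat \<Rightarrow> bool" where
  "word_ok X [] r c = (r = c)"
| "word_ok X (i # w) r c =
     (i < length X \<and> dim_row (X!i) = r \<and> word_ok X w (dim_col (X!i)) c)"

fun word_val :: "'a::semiring_1 mat list \<Rightarrow> nat list \<Rightarrow> nat \<Rightarrow> 'a mat" where
  "word_val X [] r = 1\<^sub>m r"
| "word_val X (i # w) r = X!i * word_val X w (dim_col (X!i))"

text \<open>Substitution into a polynomial, producing an r \<times> c block: defined iff
  every monomial occurring with nonzero coefficient evaluates to an r \<times> c matrix
  (so scalars c become c I and the zero polynomial becomes a zero block).\<close>
definition ncpoly_ok :: "'a::zero mat list \<Rightarrow> 'a ncpoly \<Rightarrow> nat \<Rightarrow> nat \<Rightarrow> bool" where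
  "ncpoly_ok X P r c = (\<forall>w \<in> ncpoly_supp P. word_ok X w r c)"

definition ncpoly_val :: "'a::semiring_1 mat list \<Rightarrow> 'a ncpoly \<Rightarrow> nat \<Rightarrow> nat \<Rightarrow> 'a mat" where
  "ncpoly_val X P r c =
     mat r c (\<lambda>(i,j). \<Sum>w \<in> ncpoly_supp P. P w * (word_val X w r) $$ (i,j))"

text \<open>A matrix of polynomials: (number of block rows p, number of block columns q,
  entries E r s for r < p, s < q).\<close>
type_synonym 'a ncpoly_mat = "nat \<times> nat \<times> (nat \<Rightarrow> nat \<Rightarrow> 'a ncpoly)"

definition is_ncpoly_mat :: "'a::zero ncpoly_mat \<Rightarrow> bool" where
  "is_ncpoly_mat T = (case T of (p, q, E) \<Rightarrow>
     (\<forall>r<p. \<forall>s<q. finite (ncpoly_supp (E r s))))"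

definition block :: "'a mat \<Rightarrow> nat list \<Rightarrow> nat list \<Rightarrow> nat \<Rightarrow> nat \<Rightarrow> 'a mat" where
  "block M hs ws r s = mat (hs!r) (ws!s)
     (\<lambda>(i,j). M $$ (sum_list (take r hs) + i, sum_list (take s ws) + j))"

text \<open>subst_mat T X M: substituting X blockwise into T is well defined (with
  block row heights hs and block column widths ws) and yields M.\<close>
definition subst_mat :: "'a::semiring_1 ncpoly_mat \<Rightarrow> 'a mat list \<Rightarrow> 'a mat \<Rightarrow> bool" where
  "subst_mat T X M = (case T of (p, q, E) \<Rightarrow>
     \<exists>hs ws. length hs = p \<and> length ws = q \<and>
       M \<in> carrier_mat (sum_list hs) (sum_list ws) \<and>
       (\<forall>r<p. \<forall>s<q. ncpoly_ok X (E r s) (hs!r) (ws!s) \<and>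
          block M hs ws r s = ncpoly_val X (E r s) (hs!r) (ws!s)))"

definition subst_tuple :: "'a::semiring_1 ncpoly_mat list \<Rightarrow> 'a mat list \<Rightarrow> 'a mat list \<Rightarrow> bool" where
  "subst_tuple Ts X Ms = (length Ms = length Ts \<and> (\<forall>k < length Ts. subst_mat (Ts!k) X (Ms!k)))"

section \<open>Containment of matrix problems\<close>

text \<open>contains B A: B contains A.  The tuple T(X) must be defined for every
  X in A_1, lie in B_1, and reductions must correspond (for every way of
  performing the substitution).\<close>
definition contains :: "'a::semiring_1 matrix_problem \<Rightarrow> 'a matrix_problem \<Rightarrow> bool" where
  "contains B A = (\<exists>Ts. (\<forall>T \<in> set Ts. is_ncpoly_mat T) \<and>
     (\<forall>X \<in> fst A. \<exists>Ms. subst_tuple Ts X Ms) \<and>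
     (\<forall>X \<in> fst A. \<forall>Ms. subst_tuple Ts X Ms \<longrightarrow> Ms \<in> fst B) \<and>
     (\<forall>X \<in> fst A. \<forall>X' \<in> fst A. \<forall>Ms Ms'. subst_tuple Ts X Ms \<longrightarrow> subst_tuple Ts X' Ms' \<longrightarrow>
        (snd A X X' \<longleftrightarrow> snd B Ms Ms')))"

end

theory Submission
  imports Defs "Jordan_Normal_Form.Determinant"
begin

text \<open>
  Let \<open>W = W\<^sub>1 \<oplus> \<dots> \<oplus> W\<^sub>t\<close> and let \<open>A : W \<rightarrow> V\<close> be a representation of the poset. The admissible
  changes of basis of \<open>W\<close> are exactly the automorphisms that preserve every subspace
  \<open>U\<^sub>x = (\<Oplus>i \<preceq> x. W\<^sub>i)\<close>. On \<open>V \<oplus> W \<otimes> k^(t+2) \<oplus> (\<Oplus>x. U\<^sub>x)\<close> let \<open>J\<close> shift the copies of \<open>W\<close>, and let \<open>N\<close>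
  embed each \<open>U\<^sub>x\<close> into its own copy of \<open>W\<close> and map one copy of \<open>W\<close> to \<open>V\<close> by \<open>A\<close>. Commuting with the
  nilpotent \<open>J\<close> makes an intertwiner block Toeplitz triangular on the copies of \<open>W\<close>, so it acts by one
  \<open>g\<close> along the diagonal; commuting with \<open>N\<close> forces \<open>g\<close> to preserve every \<open>U\<^sub>x\<close> and to be compatible
  with \<open>A\<close>. Nothing is assumed about the field, so eigenvalues cannot be used to separate blocks.

  Substitution must determine all block sizes from the nonzero entries of each of the two matrices
  separately. Hence the pair \<open>(J, N)\<close> is replaced by \<open>P = 1 + J + N\<close> and \<open>Q = 1 + J + (J + N)\<^sup>2\<close>, from
  which \<open>J = Q - 1 - (P - 1)\<^sup>2\<close> and \<open>N = P - 1 - J\<close> are recovered.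
\<close>

section \<open>Invertible matrices as products of elementary matrices\<close>

text \<open>The zero polynomial may be substituted at any block size, and containment speaks of
  every way to substitute. In \<open>J\<close> the blocks of \<open>V\<close> and of all
  \<open>U_x\<close> meet only zeros, so the pair \<open>(J, N)\<close> itself would leave sizes
  free. Adding 1 ties the height of each block to its width. The second matrix must also contain
  \<open>A\<close> and the embeddings, and still let \<open>J\<close> be recovered;
  \<open>(J + N)^2\<close> achieves this because it is a function of the first matrix. For the
  square to contain \<open>A\<close> in a column of a copy of \<open>W\<close>, the map
  \<open>A\<close> has to start at a copy that \<open>J\<close> reaches, hence at copy 1 and not at
  copy 0.

  Reductions are generated by single transformations, whereas similarity yields whole invertible
  matrices. The bridge is the equation \<open>X g = H X'\<close> with \<open>g\<close> supported on
  the order, and it is crossed by factoring invertible matrices into elementary ones. An intertwiner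
  \<open>F\<close> with inverse \<open>G\<close> need not be block diagonal; it is enough that in
  \<open>F G\<close> and \<open>G F\<close> the other blocks contribute nothing to the diagonal
  blocks of \<open>V\<close> and of one copy of \<open>W\<close>.\<close>

inductive elem_prod :: "nat \<Rightarrow> 'a::field mat \<Rightarrow> bool" for n where
  one: "elem_prod n (1\<^sub>m n)"
| swap: "elem_prod n P \<Longrightarrow> k < n \<Longrightarrow> l < n \<Longrightarrow> elem_prod n (P * swaprows_mat n k l)"
| scale: "elem_prod n P \<Longrightarrow> k < n \<Longrightarrow> a \<noteq> 0 \<Longrightarrow> elem_prod n (P * multrow_mat n k a)"
| add: "elem_prod n P \<Longrightarrow> k < n \<Longrightarrow> l < n \<Longrightarrow> k \<noteq> l \<Longrightarrow> elem_prod n (P * addrow_mat n a k l)"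

lemma elem_prod_carrier: "elem_prod n P \<Longrightarrow> P \<in> carrier_mat n n"
  by (induction rule: elem_prod.induct) auto

lemma elem_prod_mult:
  assumes "elem_prod n P" "elem_prod n P'"
  shows "elem_prod n (P * P')"
proof -
  have assoc: "P * (Q * E) = P * Q * E" if "elem_prod n Q" "E \<in> carrier_mat n n" for Q E
    using assms(1) that by (metis assoc_mult_mat elem_prod_carrier)
  show ?thesis
    using assms(2)
    by (induction rule: elem_prod.induct)
      (use assms(1) in \<open>auto simp: assoc elem_prod_carrier right_mult_one_mat[OF elem_prod_carrier] intro: elem_prod.intros\<close>)
qed

text \<open>One \<open>P\<close> serves for every \<open>B\<close>, because the list of row
  additions is fixed in advance. Gauss-Jordan reads the coefficients off the left matrix and applies
  them to both matrices.\<close>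

lemma elem_prod_eliminate_entries:
  assumes "i < n" "\<And>a i'. (a, i') \<in> set is \<Longrightarrow> i' < n \<and> i' \<noteq> i"
  shows "\<exists>P. elem_prod n P \<and>
    (\<forall>B nc. B \<in> carrier_mat n nc \<longrightarrow> eliminate_entries_rec B i is = P * (B :: 'a::field mat))"
  using assms(2)
proof (induction "is")
  case Nil
  show ?case by (rule exI[of _ "1\<^sub>m n"]) (auto intro: elem_prod.one)
next
  case (Cons ai "is")
  obtain a i' where ai: "ai = (a, i')" by force
  with Cons.prems have i': "i' < n" "i' \<noteq> i" by auto
  from Cons obtain P where P: "elem_prod n P"
    and id: "\<And>B nc. B \<in> carrier_mat n nc \<Longrightarrow> eliminate_entries_rec B i is = P * B" by force
  show ?case
  proof (intro exI conjI allI impI)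
    show "elem_prod n (P * addrow_mat n a i' i)"
      using P i' assms(1) by (auto intro: elem_prod.add)
    fix B :: "'a mat" and nc
    assume B: "B \<in> carrier_mat n nc"
    have "eliminate_entries_rec B i (ai # is) = P * addrow a i' i B"
      unfolding ai by (simp add: id[of "addrow a i' i B" nc] B)
    also have "\<dots> = P * (addrow_mat n a i' i * B)"
      using addrow_mat[OF B assms(1)] by simp
    also have "\<dots> = P * addrow_mat n a i' i * B"
      by (rule assoc_mult_mat[symmetric, OF elem_prod_carrier[OF P] _ B]) simp
    finally show "eliminate_entries_rec B i (ai # is) = P * addrow_mat n a i' i * B" .
  qed
qed

text \<open>Follows the recursion of \<open>gauss_jordan_main\<close>: each normalisation of a
  pivot, clearing of a column or exchange of rows becomes a new right factor of one \<open>P\<close>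
  common to both matrices.\<close>

lemma elem_prod_gauss_jordan_main:
  assumes "A \<in> carrier_mat nr nc" "B \<in> carrier_mat nr nc'"
    "gauss_jordan_main A B i j = (A', B')"
  shows "\<exists>P. elem_prod nr P \<and> A' = P * A \<and> B' = P * B"
  using assms
proof (induction A B i j rule: gauss_jordan_main.induct)
  case (1 A B i j)
  note A = 1(5) and B = 1(6) and res = 1(7)
  from A B have dim: "dim_row A = nr" "dim_col A = nc" "dim_row B = nr" "dim_col B = nc'" by auto
  note IH = 1(1-4)[OF dim(1,2)[symmetric]]
  note simp = gauss_jordan_main.simps[of A B i j] Let_def
  show ?case
  proof (cases "i < nr \<and> j < nc")
    case False
    with res have "A' = A" "B' = B" unfolding simp dim by auto
    then show ?thesis using A B elem_prod.one by (metis left_mult_one_mat)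
  next
    case True
    note valid = True
    note IH = IH[OF valid refl]
    show ?thesis
    proof (cases "A $$ (i,j) = 0")
      case nZ: False
      note IH = IH(3-4)[OF nZ]
      show ?thesis
      proof (cases "A $$ (i,j) = 1")
        case nO: False
        let ?inv = "inverse (A $$ (i,j))"
        from nO nZ valid res
        have "gauss_jordan_main (multrow i ?inv A) (multrow i ?inv B) i j = (A',B')"
          unfolding simp dim by simp
        from IH(2)[OF nO refl, unfolded multrow_carrier, OF A B this]
        obtain P where P: "elem_prod nr P"
          and id: "A' = P * multrow i ?inv A" "B' = P * multrow i ?inv B" by blast
        have "elem_prod nr (P * multrow_mat nr i ?inv)"
          using P nZ valid by (auto intro: elem_prod.scale)
        then show ?thesis
          using id elem_prod_carrier[OF P] A B
          by (intro exI[of _ "P * multrow_mat nr i ?inv"])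
            (simp add: multrow_mat[OF A] multrow_mat[OF B] assoc_mult_mat[of P nr nr _ nr A nc]
              assoc_mult_mat[of P nr nr _ nr B nc'])
      next
        case O: True
        let ?ais = "map (\<lambda>i'. (- A $$ (i',j), i')) (filter (\<lambda>i'. i' \<noteq> i) [0 ..< nr])"
        let ?E = "\<lambda>B. eliminate_entries (\<lambda>i. A $$ (i,j)) B i j"
        let ?EE = "\<lambda>B. eliminate_entries_rec B i ?ais"
        from O nZ valid res have "gauss_jordan_main (?E A) (?E B) (Suc i) (Suc j) = (A',B')"
          unfolding simp dim by simp
        from IH(1)[OF O refl carrier_eliminate_entries(1)[OF A] carrier_eliminate_entries(1)[OF B] this]
        obtain P where P: "elem_prod nr P" and id: "A' = P * ?E A" "B' = P * ?E B" by blast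
        have E: "?E A = ?EE A" "?E B = ?EE B"
          by (rule eliminate_entries_convert[of j A i, unfolded dim]; use valid dim in simp)+
        have "\<exists>P'. elem_prod nr P' \<and> (\<forall>B nc. B \<in> carrier_mat nr nc \<longrightarrow> ?EE B = P' * B)"
          by (rule elem_prod_eliminate_entries) (use valid in auto)
        then obtain P' where P': "elem_prod nr P'"
          and id': "\<And>B nc. B \<in> carrier_mat nr nc \<Longrightarrow> ?EE B = P' * B" by blast
        have "elem_prod nr (P * P')"
          using P P' by (rule elem_prod_mult)
        then show ?thesis
          using id elem_prod_carrier[OF P] elem_prod_carrier[OF P'] A B unfolding E
          by (intro exI[of _ "P * P'"]) (simp add: id'[OF A] id'[OF B] assoc_mult_mat[of P nr nr _ nr A nc]
              assoc_mult_mat[of P nr nr _ nr B nc'])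
      qed
    next
      case Z: True
      note IH = IH(1-2)[OF Z]
      let ?is = "[ i' . i' <- [Suc i ..< nr],  A $$ (i',j) \<noteq> 0]"
      show ?thesis
      proof (cases ?is)
        case Nil
        from Z valid res have "gauss_jordan_main A B i (Suc j) = (A',B')"
          unfolding simp dim Nil by simp
        from IH(1)[OF Nil A B this] show ?thesis .
      next
        case (Cons i' iss)
        from Z valid res have "gauss_jordan_main (swaprows i i' A) (swaprows i i' B) i j = (A',B')"
          unfolding simp dim Cons by simp
        from IH(2)[OF Cons, unfolded swaprows_carrier, OF A B this]
        obtain P where P: "elem_prod nr P"
          and id: "A' = P * swaprows i i' A" "B' = P * swaprows i i' B" by blast
        have "i' \<in> set ?is" unfolding Cons by simp
        then have i': "i' < nr" by auto
        have "elem_prod nr (P * swaprows_mat nr i i')"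
          using P valid i' by (auto intro: elem_prod.swap)
        then show ?thesis
          using id elem_prod_carrier[OF P] A B valid i'
          by (intro exI[of _ "P * swaprows_mat nr i i'"])
            (simp add: swaprows_mat[OF A] swaprows_mat[OF B] assoc_mult_mat[of P nr nr _ nr A nc]
              assoc_mult_mat[of P nr nr _ nr B nc'])
      qed
    qed
  qed
qed

lemma elem_prod_invertible:
  assumes "H \<in> carrier_mat n n" "K \<in> carrier_mat n n" "H * K = 1\<^sub>m n" "K * H = 1\<^sub>m n"
  shows "elem_prod n (H :: 'a::field mat)"
proof -
  \<comment> \<open>Gauss-Jordan turns the unit \<open>K\<close> into the identity, so the recorded
    product satisfies \<open>P * K = 1\<close>. What has been factored is therefore the inverse of
    \<open>K\<close>, namely \<open>H\<close>.\<close>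
  have "K \<in> Units (ring_mat TYPE('a) n ())"
    using assms by (auto simp: Units_def ring_mat_def)
  from gauss_jordan_inverse_other_direction[OF this, of "1\<^sub>m n" n]
  obtain B' where "gauss_jordan K (1\<^sub>m n) = (1\<^sub>m n, B')"
    by (metis one_carrier_mat prod.collapse)
  from elem_prod_gauss_jordan_main[OF assms(2) one_carrier_mat this[unfolded gauss_jordan_def]]
  obtain P where P: "elem_prod n P" "1\<^sub>m n = P * K" by blast
  have "H = P * K * H" unfolding P(2)[symmetric] using assms by simp
  also have "\<dots> = P" using assms elem_prod_carrier[OF P(1)] by (simp add: assoc_mult_mat[of P n n K n H n])
  finally show ?thesis using P by simp
qed

section \<open>Multiplication by elementary products as a sequence of admissible
  transformations\<close>

lemma poset_reps_iff:
  "X \<in> poset_reps t \<longleftrightarrow> length X = t \<and> (\<exists>m. \<forall>i<t. dim_row (X!i) = m)"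
  unfolding poset_reps_def by (cases t) auto

lemma poset_reps_dim_row:
  "X \<in> poset_reps t \<Longrightarrow> A \<in> set X \<Longrightarrow> dim_row A = dim_row (X!0)"
  by (metis gr_zeroI in_set_conv_nth not_less_zero poset_reps_iff)

lemma poset_reps_map:
  "X \<in> poset_reps t \<Longrightarrow> (\<And>A. A \<in> set X \<Longrightarrow> dim_row (f A) = m) \<Longrightarrow> map f X \<in> poset_reps t"
  by (auto simp: poset_reps_iff)

lemma poset_reps_update:
  "X \<in> poset_reps t \<Longrightarrow> j < t \<Longrightarrow> dim_row A = dim_row (X!j) \<Longrightarrow> X[j := A] \<in> poset_reps t"
  by (auto simp: poset_reps_iff nth_list_update)

lemma elementary_ops_eq:
  "swap_rows k l A = swaprows k l A" "scale_row k a A = multrow k a A"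
  "add_row k l a A = addrow a k l A" "swap_cols k l A = swapcols k l A"
  "scale_col k a A = multcol k a A" "add_col k l a A = addcol a k l A"
  by (rule eq_matI; force simp: swap_rows_def mat_swaprows_def scale_row_def mat_multrow_def
      add_row_def mat_addrow_def swap_cols_def mat_swapcols_def scale_col_def mat_multcol_def
      add_col_def mat_addcol_def add.commute)+

text \<open>\<open>P * E\<close> acts on rows by \<open>E\<close> first and by \<open>P\<close>
  afterwards. The induction hypothesis is thus applied to the representation already changed by
  \<open>E\<close>, which is why \<open>X\<close> is generalised.\<close>

lemma poset_steps_mult_row:
  assumes "elem_prod m P" "X \<in> poset_reps t" "0 < t" "m = dim_row (X!0)"
  shows "(poset_step t R)\<^sup>*\<^sup>* X (map ((*) P) X)"
  using assms(1,2,4)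
proof (induction arbitrary: X rule: elem_prod.induct)
  case one
  then have "map ((*) (1\<^sub>m m)) X = X"
    by (intro map_idI) (auto intro!: left_mult_one_mat' poset_reps_dim_row)
  then show ?case by simp
next
  case (swap P k l)
  have c: "A \<in> set X \<Longrightarrow> A \<in> carrier_mat m (dim_col A)" for A
    using poset_reps_dim_row[of X t A] swap.prems by auto
  let ?E = "swaprows_mat m k l"
  have "poset_step t R X (map (swap_rows k l) X)"
    using swap by (auto intro: poset_step.row_swap)
  also have "map (swap_rows k l) X = map ((*) ?E) X"
    using swap.hyps by (simp add: swaprows_mat[OF c] elementary_ops_eq)
  finally have 1: "poset_step t R X (map ((*) ?E) X)" .
  have "(poset_step t R)\<^sup>*\<^sup>* (map ((*) ?E) X) (map ((*) P) (map ((*) ?E) X))"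
    using swap.prems poset_reps_map[OF swap.prems(1), of "(*) ?E" m] assms(3)
    by (intro swap.IH) (auto simp: poset_reps_iff)
  also have "map ((*) P) (map ((*) ?E) X) = map ((*) (P * ?E)) X"
    using elem_prod_carrier[OF swap.hyps(1)] c by (auto intro!: assoc_mult_mat[symmetric])
  finally show ?case using 1 by (simp add: converse_rtranclp_into_rtranclp)
next
  case (scale P k a)
  have c: "A \<in> set X \<Longrightarrow> A \<in> carrier_mat m (dim_col A)" for A
    using poset_reps_dim_row[of X t A] scale.prems by auto
  let ?E = "multrow_mat m k a"
  have "poset_step t R X (map (scale_row k a) X)"
    using scale by (auto intro: poset_step.row_scale)
  also have "map (scale_row k a) X = map ((*) ?E) X"
    by (simp add: multrow_mat[OF c] elementary_ops_eq)
  finally have 1: "poset_step t R X (map ((*) ?E) X)" .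
  have "(poset_step t R)\<^sup>*\<^sup>* (map ((*) ?E) X) (map ((*) P) (map ((*) ?E) X))"
    using scale.prems poset_reps_map[OF scale.prems(1), of "(*) ?E" m] assms(3)
    by (intro scale.IH) (auto simp: poset_reps_iff)
  also have "map ((*) P) (map ((*) ?E) X) = map ((*) (P * ?E)) X"
    using elem_prod_carrier[OF scale.hyps(1)] c by (auto intro!: assoc_mult_mat[symmetric])
  finally show ?case using 1 by (simp add: converse_rtranclp_into_rtranclp)
next
  case (add P k l a)
  have c: "A \<in> set X \<Longrightarrow> A \<in> carrier_mat m (dim_col A)" for A
    using poset_reps_dim_row[of X t A] add.prems by auto
  let ?E = "addrow_mat m a k l"
  have "poset_step t R X (map (add_row k l a) X)"
    using add by (auto intro: poset_step.row_add)
  also have "map (add_row k l a) X = map ((*) ?E) X"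
    using add.hyps by (simp add: addrow_mat[OF c] elementary_ops_eq)
  finally have 1: "poset_step t R X (map ((*) ?E) X)" .
  have "(poset_step t R)\<^sup>*\<^sup>* (map ((*) ?E) X) (map ((*) P) (map ((*) ?E) X))"
    using add.prems poset_reps_map[OF add.prems(1), of "(*) ?E" m] assms(3)
    by (intro add.IH) (auto simp: poset_reps_iff)
  also have "map ((*) P) (map ((*) ?E) X) = map ((*) (P * ?E)) X"
    using elem_prod_carrier[OF add.hyps(1)] c by (auto intro!: assoc_mult_mat[symmetric])
  finally show ?case using 1 by (simp add: converse_rtranclp_into_rtranclp)
qed

text \<open>On the right the order is reversed: \<open>P\<close> acts first and the elementary
  factor is the last step, so \<open>X\<close> stays fixed in the induction.\<close>

lemma poset_steps_mult_col:
  assumes "elem_prod n P" "X \<in> poset_reps t" "j < t" "n = dim_col (X!j)"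
  shows "(poset_step t R)\<^sup>*\<^sup>* X (X[j := X!j * P])"
  using assms(1,2,4)
proof (induction rule: elem_prod.induct)
  case one
  then have "X!j * 1\<^sub>m n = X!j" by (simp add: right_mult_one_mat')
  then show ?case by simp
next
  case (swap P k l)
  let ?Y = "X[j := X!j * P]"
  have len: "length X = t" and Y: "?Y \<in> poset_reps t"
    using swap.prems assms(3) poset_reps_update
    by (simp_all add: poset_reps_iff[of X] poset_reps_update)
  have P: "P \<in> carrier_mat n n" by (rule elem_prod_carrier) fact
  have c: "X!j * P \<in> carrier_mat (dim_row (X!j)) n" using P by auto
  have "poset_step t R ?Y (?Y[Suc j - 1 := swap_cols k l (?Y!(Suc j - 1))])"
    using Y assms(3) len swap.hyps P by (intro poset_step.col_swap) auto
  also have "swap_cols k l (?Y!(Suc j - 1)) = X!j * P * swaprows_mat n k l"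
    using assms(3) len swapcols_mat[OF c swap.hyps(2,3)] by (simp add: elementary_ops_eq)
  also have "\<dots> = X!j * (P * swaprows_mat n k l)"
    using P swap.prems by (intro assoc_mult_mat[of _ "dim_row (X!j)" n]) auto
  finally show ?case using swap.IH[OF swap.prems] by (simp add: rtranclp.rtrancl_into_rtrancl)
next
  case (scale P k a)
  let ?Y = "X[j := X!j * P]"
  have len: "length X = t" and Y: "?Y \<in> poset_reps t"
    using scale.prems assms(3) poset_reps_update
    by (simp_all add: poset_reps_iff[of X] poset_reps_update)
  have P: "P \<in> carrier_mat n n" by (rule elem_prod_carrier) fact
  have c: "X!j * P \<in> carrier_mat (dim_row (X!j)) n" using P by auto
  have "poset_step t R ?Y (?Y[Suc j - 1 := scale_col k a (?Y!(Suc j - 1))])"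
    using Y assms(3) len scale.hyps P by (intro poset_step.col_scale) auto
  also have "scale_col k a (?Y!(Suc j - 1)) = X!j * P * multrow_mat n k a"
    using assms(3) len multcol_mat[OF c, of k a] by (simp add: elementary_ops_eq)
  also have "\<dots> = X!j * (P * multrow_mat n k a)"
    using P scale.prems by (intro assoc_mult_mat[of _ "dim_row (X!j)" n]) auto
  finally show ?case using scale.IH[OF scale.prems] by (simp add: rtranclp.rtrancl_into_rtrancl)
next
  case (add P k l a)
  let ?Y = "X[j := X!j * P]"
  have len: "length X = t" and Y: "?Y \<in> poset_reps t"
    using add.prems assms(3) poset_reps_update
    by (simp_all add: poset_reps_iff[of X] poset_reps_update)
  have P: "P \<in> carrier_mat n n" by (rule elem_prod_carrier) fact
  have c: "X!j * P \<in> carrier_mat (dim_row (X!j)) n" using P by auto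
  have "poset_step t R ?Y (?Y[Suc j - 1 := add_col l k a (?Y!(Suc j - 1))])"
    using Y assms(3) len add.hyps P by (intro poset_step.col_add) auto
  also have "add_col l k a (?Y!(Suc j - 1)) = X!j * P * addrow_mat n a k l"
    using assms(3) len addcol_mat[OF c add.hyps(2), of a l] by (simp add: elementary_ops_eq)
  also have "\<dots> = X!j * (P * addrow_mat n a k l)"
    using P add.prems by (intro assoc_mult_mat[of _ "dim_row (X!j)" n]) auto
  finally show ?case using add.IH[OF add.prems] by (simp add: rtranclp.rtrancl_into_rtrancl)
qed

section \<open>Isomorphism of representations\<close>

text \<open>Invertibility for matrices indexed by sets, with different sets for rows and columns.
  Equality of sizes is thereby a consequence over a field, and strips can be indexed by pairs
  without enumerating them.\<close>

definition mutually_inverse ::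
  "'i set \<Rightarrow> 'j set \<Rightarrow> ('i \<Rightarrow> 'j \<Rightarrow> 'a::comm_ring_1) \<Rightarrow> ('j \<Rightarrow> 'i \<Rightarrow> 'a) \<Rightarrow> bool" where
  "mutually_inverse I J F G \<longleftrightarrow>
     (\<forall>a\<in>I. \<forall>a'\<in>I. (\<Sum>b\<in>J. F a b * G b a') = of_bool (a = a')) \<and>
     (\<forall>b\<in>J. \<forall>b'\<in>J. (\<Sum>a\<in>I. G b a * F a b') = of_bool (b = b'))"

lemma mutually_inverse_sym: "mutually_inverse I J F G \<Longrightarrow> mutually_inverse J I G F"
  unfolding mutually_inverse_def by blast

lemma sum_mult_mat:
  assumes "A \<in> carrier_mat m n" "B \<in> carrier_mat n k" "i < m" "j < k"
  shows "(A * B) $$ (i, j) = (\<Sum>l<n. A $$ (i, l) * B $$ (l, j))"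
  using assms by (auto simp: scalar_prod_def atLeast0LessThan intro!: sum.cong)

text \<open>If \<open>m < n\<close>, padding \<open>F\<close> by zero rows and \<open>G\<close> by
  zero columns gives square matrices with \<open>?G * ?F = 1\<close>. Then
  \<open>?F * ?G = 1\<close> as well, which is impossible because row \<open>m\<close> of
  \<open>?F\<close> is zero.\<close>

lemma mutually_inverse_le:
  fixes F :: "nat \<Rightarrow> nat \<Rightarrow> 'a::field"
  assumes "mutually_inverse {..<m} {..<n} F G"
  shows "n \<le> m"
proof (rule ccontr)
  assume "\<not> n \<le> m"
  then have mn: "m < n" by simp
  let ?F = "mat n n (\<lambda>(i, j). if i < m then F i j else 0)"
  let ?G = "mat n n (\<lambda>(i, j). if j < m then G i j else 0)"
  have "(?G * ?F) $$ (b, b') = 1\<^sub>m n $$ (b, b')" if b: "b < n" "b' < n" for b b'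
  proof -
    have "(?G * ?F) $$ (b, b') = (\<Sum>l<n. ?G $$ (b, l) * ?F $$ (l, b'))"
      by (rule sum_mult_mat) (use b in auto)
    also have "\<dots> = (\<Sum>l<m. G b l * F l b')"
      by (rule sum.mono_neutral_cong_right) (use b mn in auto)
    also have "\<dots> = 1\<^sub>m n $$ (b, b')"
      using assms b by (auto simp: mutually_inverse_def)
    finally show ?thesis .
  qed
  then have "?G * ?F = 1\<^sub>m n" by (intro eq_matI) auto
  then have "?F * ?G = 1\<^sub>m n" by (rule mat_mult_left_right_inverse[of _ n, rotated 2]) simp_all
  then have "1 = (?F * ?G) $$ (m, m)" using mn by simp
  also have "\<dots> = (\<Sum>l<n. ?F $$ (m, l) * ?G $$ (l, m))"
    by (rule sum_mult_mat) (use mn in auto)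
  also have "\<dots> = 0" using mn by simp
  finally show False by simp
qed

lemma mutually_inverse_eq:
  fixes F :: "nat \<Rightarrow> nat \<Rightarrow> 'a::field"
  assumes "mutually_inverse {..<m} {..<n} F G"
  shows "m = n"
  using mutually_inverse_le[OF assms] mutually_inverse_le[OF mutually_inverse_sym[OF assms]] by simp

lemma mutually_inverse_mat:
  assumes "mutually_inverse {..<n} {..<n} F G"
  shows "mat n n (\<lambda>(i, j). F i j) * mat n n (\<lambda>(i, j). G i j) = 1\<^sub>m n"
proof (rule eq_matI)
  fix i j assume ij: "i < dim_row (1\<^sub>m n :: 'a mat)" "j < dim_col (1\<^sub>m n :: 'a mat)"
  then have "(mat n n (\<lambda>(i, j). F i j) * mat n n (\<lambda>(i, j). G i j)) $$ (i, j) =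
    (\<Sum>l<n. mat n n (\<lambda>(i, j). F i j) $$ (i, l) * mat n n (\<lambda>(i, j). G i j) $$ (l, j))"
    by (intro sum_mult_mat) auto
  also have "\<dots> = (\<Sum>l<n. F i l * G l j)" using ij by (intro sum.cong) auto
  also have "\<dots> = 1\<^sub>m n $$ (i, j)" using assms ij by (simp add: mutually_inverse_def)
  finally show "(mat n n (\<lambda>(i, j). F i j) * mat n n (\<lambda>(i, j). G i j)) $$ (i, j) = 1\<^sub>m n $$ (i, j)" .
qed auto

definition strip_index :: "'a mat list \<Rightarrow> (nat \<times> nat) set" where
  "strip_index X = (SIGMA i:{..<length X}. {..<dim_col (X!i)})"

lemma finite_strip_index [simp]: "finite (strip_index X)"
  by (simp add: strip_index_def)

text \<open>The poset elements are \<open>1, \<dots>, t\<close> but lists are indexed from \<open>0\<close>, hence the shifts by one.\<close>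

definition order_supported :: "(nat \<times> nat) set \<Rightarrow> (nat \<times> nat \<Rightarrow> nat \<times> nat \<Rightarrow> 'a::zero) \<Rightarrow> bool" where
  "order_supported R g \<longleftrightarrow> (\<forall>a b. g a b \<noteq> 0 \<longrightarrow> (Suc (fst a), Suc (fst b)) \<in> R)"

lemma order_supportedD:
  "order_supported R g \<Longrightarrow> g a b \<noteq> 0 \<Longrightarrow> (Suc (fst a), Suc (fst b)) \<in> R"
  unfolding order_supported_def by blast

text \<open>The matrix equation \<open>X g = H X'\<close>. Placing \<open>H\<close> on the side of
  \<open>X'\<close> gives it the shape of an intertwining relation. The support condition says that
  a column of a strip uses only columns of its own strip and of strips below it.\<close>

definition rep_iso :: "(nat \<times> nat) set \<Rightarrow> 'a::field mat list \<Rightarrow> 'a mat list \<Rightarrow> bool" where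
  "rep_iso R X X' \<longleftrightarrow> (\<exists>H H' g g'.
     mutually_inverse {..<dim_row (X!0)} {..<dim_row (X'!0)} H H' \<and>
     mutually_inverse (strip_index X) (strip_index X') g g' \<and>
     order_supported R g \<and> order_supported R g' \<and>
     (\<forall>p<dim_row (X!0). \<forall>b\<in>strip_index X'.
       (\<Sum>a\<in>strip_index X. X!fst a $$ (p, snd a) * g a b) =
       (\<Sum>r<dim_row (X'!0). H p r * X'!fst b $$ (r, snd b))))"

text \<open>For \<open>i \<noteq> j\<close> a term leading from strip \<open>j\<close> through strip
  \<open>i\<close> and back would need both relations between \<open>i\<close> and \<open>j\<close>,
  which antisymmetry excludes. So the diagonal blocks multiply among themselves, and corresponding
  strips have equal width.\<close>

lemma mutually_inverse_diag_block:
  fixes X X' :: "'a mat list" and g g' :: "nat \<times> nat \<Rightarrow> nat \<times> nat \<Rightarrow> 'b::idom"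
  assumes R: "partial_order_on {1..t} R"
    and inv: "mutually_inverse (strip_index X) (strip_index X') g g'"
    and supp: "order_supported R g" "order_supported R g'"
    and j: "j < length X" "j < length X'"
  shows "mutually_inverse {..<dim_col (X!j)} {..<dim_col (X'!j)}
    (\<lambda>p q. g (j, p) (j, q)) (\<lambda>p q. g' (j, p) (j, q))"
proof -
  have "antisym R" using R by (simp add: partial_order_on_def)
  have zero: "f (j, p) (i, q) * f' (i, q) (j, r) = 0"
    if "order_supported R f" "order_supported R f'" "i \<noteq> j" for f f' :: "nat \<times> nat \<Rightarrow> nat \<times> nat \<Rightarrow> 'b" and p q r i
  proof (rule ccontr)
    assume "f (j, p) (i, q) * f' (i, q) (j, r) \<noteq> 0"
    then have "(Suc j, Suc i) \<in> R" "(Suc i, Suc j) \<in> R"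
      using that(1,2) unfolding order_supported_def by (metis fst_conv mult_zero_left, metis fst_conv mult_zero_right)
    then show False using \<open>antisym R\<close> that(3) by (auto dest: antisymD)
  qed
  have sum: "(\<Sum>b\<in>strip_index Y. f (j, p) b * f' b (j, r)) =
      (\<Sum>q<dim_col (Y!j). f (j, p) (j, q) * f' (j, q) (j, r))"
    if "order_supported R f" "order_supported R f'" "j < length Y"
    for f f' :: "nat \<times> nat \<Rightarrow> nat \<times> nat \<Rightarrow> 'b" and p r and Y :: "'a mat list"
  proof -
    have "(\<Sum>b\<in>strip_index Y. f (j, p) b * f' b (j, r)) =
      (\<Sum>b\<in>Pair j ` {..<dim_col (Y!j)}. f (j, p) b * f' b (j, r))"
      by (rule sum.mono_neutral_right) (use that in \<open>auto simp: strip_index_def image_iff simp del: mult_eq_0_iff intro!: zero\<close>)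
    then show ?thesis by (simp add: sum.reindex inj_on_def)
  qed
  have mem: "(j, p) \<in> strip_index Y" if "j < length Y" "p < dim_col (Y!j)" for p and Y :: "'a mat list"
    using that by (simp add: strip_index_def)
  show ?thesis
    unfolding mutually_inverse_def
    using inv j by (simp add: sum[OF supp, symmetric] sum[OF supp(2,1), symmetric] mutually_inverse_def mem)
qed

section \<open>From an isomorphism of representations to admissible transformations\<close>

lemma poset_steps_strip:
  assumes X: "X \<in> poset_reps t" and j: "j < t" and "finite F"
    and "\<And>i q p. ((i, q), p) \<in> F \<Longrightarrow>
      (Suc i, Suc j) \<in> R \<and> i < t \<and> i \<noteq> j \<and> q < dim_col (X!i) \<and> p < dim_col (X!j)"
  shows "(poset_step t R)\<^sup>*\<^sup>* X (X[j := mat (dim_row (X!j)) (dim_col (X!j))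
    (\<lambda>(r, s). X!j $$ (r, s) + (\<Sum>(a, p)\<in>F. if p = s then X!fst a $$ (r, snd a) * c a p else 0))])"
  using assms(3,4)
proof (induction F rule: finite_induct)
  case empty
  have "mat (dim_row (X!j)) (dim_col (X!j)) (\<lambda>(r, s). X!j $$ (r, s)) = X!j"
    by (rule eq_matI) auto
  then show ?case by simp
next
  case (insert x F)
  obtain i q p where x: "x = ((i, q), p)" by (metis surj_pair)
  have len: "length X = t" using X by (simp add: poset_reps_iff)
  have ipq: "(Suc i, Suc j) \<in> R" "i < t" "i \<noteq> j" "q < dim_col (X!i)" "p < dim_col (X!j)"
    using insert.prems[of i q p] by (auto simp: x)
  let ?M = "\<lambda>F. mat (dim_row (X!j)) (dim_col (X!j))
    (\<lambda>(r, s). X!j $$ (r, s) + (\<Sum>(a, p)\<in>F. if p = s then X!fst a $$ (r, snd a) * c a p else 0))"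
  let ?Y = "X[j := ?M F]"
  have Y: "?Y \<in> poset_reps t" using X j by (intro poset_reps_update) auto
  \<comment> \<open>The source strip \<open>i \<noteq> j\<close> of \<open>?Y\<close> is still the
    original one, so this addition contributes exactly one new summand.\<close>
  have "poset_step t R ?Y (?Y[Suc j - 1 := mat (dim_row (?Y!(Suc j - 1))) (dim_col (?Y!(Suc j - 1)))
        (\<lambda>(r,s). if s = p then ?Y!(Suc j - 1) $$ (r,s) + c (i, q) p * ?Y!(Suc i - 1) $$ (r,q)
                  else ?Y!(Suc j - 1) $$ (r,s))])"
    using Y ipq j len by (intro poset_step.strip_add) auto
  also have "mat (dim_row (?Y!(Suc j - 1))) (dim_col (?Y!(Suc j - 1)))
        (\<lambda>(r,s). if s = p then ?Y!(Suc j - 1) $$ (r,s) + c (i, q) p * ?Y!(Suc i - 1) $$ (r,q)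
                  else ?Y!(Suc j - 1) $$ (r,s)) = ?M (insert x F)"
    using insert.hyps j len ipq by (intro eq_matI) (auto simp: x)
  finally have "poset_step t R ?Y (X[j := ?M (insert x F)])" by simp
  moreover have "(poset_step t R)\<^sup>*\<^sup>* X ?Y"
    using insert.prems by (intro insert.IH) auto
  ultimately show ?case by (rule rtranclp.rtrancl_into_rtrancl[rotated])
qed

text \<open>Strip \<open>j\<close> of \<open>X g\<close> is the old strip times the diagonal block
  of \<open>g\<close>, plus contributions of strictly smaller strips. The first part is a product of
  elementary column transformations, the second a set of additions between strips.\<close>

lemma poset_steps_column_block:
  assumes R: "partial_order_on {1..t} R" and X: "X \<in> poset_reps t" and j: "j < t"
    and supp: "order_supported R g"
    and inv: "mutually_inverse {..<dim_col (X!j)} {..<dim_col (X!j)} (\<lambda>p q. g (j, p) (j, q)) h"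
  shows "(poset_step t R)\<^sup>*\<^sup>* X (X[j := mat (dim_row (X!j)) (dim_col (X!j))
    (\<lambda>(r, s). \<Sum>a\<in>strip_index X. X!fst a $$ (r, snd a) * g a (j, s))])"
proof -
  have len: "length X = t" using X by (simp add: poset_reps_iff)
  let ?n = "dim_col (X!j)"
  let ?G = "mat ?n ?n (\<lambda>(p, q). g (j, p) (j, q))"
  have G: "elem_prod ?n ?G"
  proof (rule elem_prod_invertible)
    show "?G * mat ?n ?n (\<lambda>(p, q). h p q) = 1\<^sub>m ?n"
      by (rule mutually_inverse_mat) fact
    show "mat ?n ?n (\<lambda>(p, q). h p q) * ?G = 1\<^sub>m ?n"
      by (rule mutually_inverse_mat[OF mutually_inverse_sym[OF inv]])
  qed auto
  let ?Y = "X[j := X!j * ?G]"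
  have Y: "?Y \<in> poset_reps t" using X j by (intro poset_reps_update) auto
  have 1: "(poset_step t R)\<^sup>*\<^sup>* X ?Y"
    by (rule poset_steps_mult_col) (use X j G in auto)
  \<comment> \<open>All pairs of a source column in a strictly smaller strip and a target column in
    strip \<open>j\<close>. A pair with coefficient zero is a harmless addition.\<close>
  define F where "F = {((i, q), p). (i, q) \<in> strip_index X \<and> i \<noteq> j \<and> (Suc i, Suc j) \<in> R \<and> p < ?n}"
  have "F \<subseteq> strip_index X \<times> {..<?n}" unfolding F_def by auto
  then have F: "finite F" by (rule finite_subset) simp
  have 2: "(poset_step t R)\<^sup>*\<^sup>* ?Y (?Y[j := mat (dim_row (?Y!j)) (dim_col (?Y!j))
    (\<lambda>(r, s). ?Y!j $$ (r, s) + (\<Sum>(a, p)\<in>F. if p = s then ?Y!fst a $$ (r, snd a) * g a (j, p) else 0))])"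
    by (rule poset_steps_strip[OF Y j F]) (use len j in \<open>auto simp: F_def strip_index_def\<close>)
  have 3: "mat (dim_row (?Y!j)) (dim_col (?Y!j))
    (\<lambda>(r, s). ?Y!j $$ (r, s) + (\<Sum>(a, p)\<in>F. if p = s then ?Y!fst a $$ (r, snd a) * g a (j, p) else 0)) =
    mat (dim_row (X!j)) ?n (\<lambda>(r, s). \<Sum>a\<in>strip_index X. X!fst a $$ (r, snd a) * g a (j, s))"
    (is "?L = ?M")
  proof (rule eq_matI)
    fix r s assume "r < dim_row ?M" "s < dim_col ?M"
    then have rs: "r < dim_row (X!j)" "s < ?n" by auto
    let ?f = "\<lambda>a. X!fst a $$ (r, snd a) * g a (j, s)"
    have "(\<Sum>(a, p)\<in>F. if p = s then ?Y!fst a $$ (r, snd a) * g a (j, p) else 0) =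
      (\<Sum>(a, p)\<in>{x \<in> F. snd x = s}. ?f a)"
      by (rule sum.mono_neutral_cong_right) (use F in \<open>auto simp: F_def split: if_splits\<close>)
    also have "\<dots> = sum ?f {a \<in> strip_index X. fst a \<noteq> j \<and> (Suc (fst a), Suc j) \<in> R}"
      by (rule sum.reindex_bij_witness[of _ "\<lambda>a. (a, s)" fst]) (use rs in \<open>auto simp: F_def\<close>)
    also have "\<dots> = sum ?f {a \<in> strip_index X. fst a \<noteq> j}"
      by (rule sum.mono_neutral_left) (auto dest!: order_supportedD[OF supp])
    finally have A: "(\<Sum>(a, p)\<in>F. if p = s then ?Y!fst a $$ (r, snd a) * g a (j, p) else 0) =
      sum ?f {a \<in> strip_index X. fst a \<noteq> j}" .
    have "(X!j * ?G) $$ (r, s) = (\<Sum>l<?n. X!j $$ (r, l) * ?G $$ (l, s))"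
      by (rule sum_mult_mat) (use rs in auto)
    also have "\<dots> = sum ?f {a \<in> strip_index X. fst a = j}"
      by (rule sum.reindex_bij_witness[of _ snd "Pair j"])
        (use rs j len in \<open>auto simp: strip_index_def\<close>)
    finally have B: "(X!j * ?G) $$ (r, s) = sum ?f {a \<in> strip_index X. fst a = j}" .
    have "sum ?f (strip_index X) = sum ?f {a \<in> strip_index X. fst a = j} + sum ?f {a \<in> strip_index X. fst a \<noteq> j}"
      by (subst sum.union_disjoint[symmetric]) (auto intro!: sum.cong)
    then show "?L $$ (r, s) = ?M $$ (r, s)"
      using rs j len A B by simp
  qed (use j len in auto)
  show ?thesis
    using 1 2 unfolding 3 list_update_overwrite by (rule rtranclp_trans)
qed

text \<open>
  The strips are replaced from the maximal poset elements downwards, so that all strips below the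
  current one still have their original content.
\<close>

lemma poset_steps_columns:
  assumes R: "partial_order_on {1..t} R" and X: "X \<in> poset_reps t"
    and supp: "order_supported R g"
    and inv: "\<And>j. j < t \<Longrightarrow> mutually_inverse {..<dim_col (X!j)} {..<dim_col (X!j)} (\<lambda>p q. g (j, p) (j, q)) (h j)"
  defines "W \<equiv> \<lambda>j. mat (dim_row (X!j)) (dim_col (X!j))
    (\<lambda>(r, s). \<Sum>a\<in>strip_index X. X!fst a $$ (r, snd a) * g a (j, s))"
  shows "(poset_step t R)\<^sup>*\<^sup>* X (map W [0..<t])"
proof -
  have len: "length X = t" using X by (simp add: poset_reps_iff)
  have antisym: "antisym R" and trans: "trans R" and refl: "refl_on {1..t} R"
    using R by (auto simp: partial_order_on_def preorder_on_def)
  define Z where "Z = (\<lambda>D. map (\<lambda>j. if j \<in> D then W j else X!j) [0..<t])"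
  have dims: "dim_row (W j) = dim_row (X!j)" "dim_col (W j) = dim_col (X!j)" for j
    by (simp_all add: W_def)
  have nth_Z: "Z D!j = (if j \<in> D then W j else X!j)" if "j < t" for D j
    using that by (simp add: Z_def)
  have len_Z: "length (Z D) = t" for D by (simp add: Z_def)
  have Z: "Z D \<in> poset_reps t" "strip_index (Z D) = strip_index X" for D
    using X by (auto simp: poset_reps_iff dims strip_index_def nth_Z len_Z split: if_splits)
  \<comment> \<open>Induction over the upward closed sets \<open>D\<close> of strips already
    replaced: a strip is replaced only after all strips above it.\<close>
  have "(poset_step t R)\<^sup>*\<^sup>* X (Z D)"
    if "D \<subseteq> {..<t}" "\<And>i j. i \<in> D \<Longrightarrow> j < t \<Longrightarrow> (Suc i, Suc j) \<in> R \<Longrightarrow> j \<in> D" for D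
    using that
  proof (induction "card D" arbitrary: D)
    case 0
    then have "D = {}" using finite_subset[OF 0(2)] by auto
    then have "Z D = X" using len by (auto simp: Z_def intro: nth_equalityI)
    then show ?case by simp
  next
    case (Suc n)
    have fin: "finite D" using Suc.prems(1) finite_subset by auto
    have "D \<noteq> {}" using Suc.hyps(2) by auto
    \<comment> \<open>The fewest predecessors in \<open>D\<close> mark a minimal element of
      \<open>D\<close>, since a smaller element would have strictly fewer. This strip is the last
      one of \<open>D\<close> to be replaced.\<close>
    define below where "below = (\<lambda>j. card {i \<in> D. (Suc i, Suc j) \<in> R})"
    obtain j where j: "j \<in> D" and least: "\<And>i. i \<in> D \<Longrightarrow> below j \<le> below i"
      using ex_min_if_finite[of "below ` D"] fin \<open>D \<noteq> {}\<close> by (auto simp: not_less)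
    have jt: "j < t" using j Suc.prems(1) by auto
    have min: "i = j" if i: "i \<in> D" "(Suc i, Suc j) \<in> R" for i
    proof (rule ccontr)
      assume "i \<noteq> j"
      then have "(Suc j, Suc i) \<notin> R" using i antisym by (auto simp: antisym_def)
      moreover have "(Suc j, Suc j) \<in> R" using refl jt by (auto simp: refl_on_def)
      ultimately have "{k \<in> D. (Suc k, Suc i) \<in> R} \<subset> {k \<in> D. (Suc k, Suc j) \<in> R}"
        using i j trans by (auto dest: transD)
      then have "below i < below j" unfolding below_def using fin by (intro psubset_card_mono) auto
      then show False using least[OF i(1)] by simp
    qed
    let ?D = "D - {j}"
    have steps1: "(poset_step t R)\<^sup>*\<^sup>* X (Z ?D)"
    proof (rule Suc.hyps(1))
      show "n = card ?D" using Suc.hyps(2) j fin by simp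
      show "?D \<subseteq> {..<t}" using Suc.prems(1) by auto
      fix i k assume "i \<in> ?D" "k < t" "(Suc i, Suc k) \<in> R"
      then show "k \<in> ?D" using Suc.prems(2)[of i k] min[of i] by auto
    qed
    have steps2: "(poset_step t R)\<^sup>*\<^sup>* (Z ?D) ((Z ?D)[j := mat (dim_row (Z ?D!j)) (dim_col (Z ?D!j))
      (\<lambda>(r, s). \<Sum>a\<in>strip_index (Z ?D). Z ?D!fst a $$ (r, snd a) * g a (j, s))])"
      by (rule poset_steps_column_block[OF R Z(1) jt supp, of _ "h j"])
        (use inv[OF jt] jt in \<open>auto simp: Z_def\<close>)
    \<comment> \<open>The strips that contribute to strip \<open>j\<close> lie below it or equal it.
      Minimality of \<open>j\<close> keeps them out of \<open>?D\<close>, so they still have their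
      original entries.\<close>
    have entries: "(\<lambda>(r, s). \<Sum>a\<in>strip_index (Z ?D). Z ?D!fst a $$ (r, snd a) * g a (j, s)) =
      (\<lambda>(r, s). \<Sum>a\<in>strip_index X. X!fst a $$ (r, snd a) * g a (j, s))"
    proof (intro ext, clarify, unfold Z, rule sum.cong, rule HOL.refl)
      fix r s a assume a: "a \<in> strip_index X"
      show "Z ?D!fst a $$ (r, snd a) * g a (j, s) = X!fst a $$ (r, snd a) * g a (j, s)"
      proof (cases "g a (j, s) = 0")
        case False
        then have "(Suc (fst a), Suc j) \<in> R" using order_supportedD[OF supp] by fastforce
        then have "fst a \<notin> ?D" using min[of "fst a"] by auto
        then show ?thesis using a len by (auto simp: Z_def strip_index_def)
      qed simp
    qed
    have "(Z ?D)[j := mat (dim_row (Z ?D!j)) (dim_col (Z ?D!j))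
      (\<lambda>(r, s). \<Sum>a\<in>strip_index X. X!fst a $$ (r, snd a) * g a (j, s))] = Z D"
      using jt j by (intro nth_equalityI) (auto simp: Z_def nth_list_update W_def)
    with steps1 steps2 show ?case by (simp only: entries)
  qed
  then have "(poset_step t R)\<^sup>*\<^sup>* X (Z {..<t})" by blast
  also have "Z {..<t} = map W [0..<t]" unfolding Z_def by simp
  finally show ?thesis .
qed

lemma rep_iso_imp_steps:
  assumes R: "partial_order_on {1..t} R" and t: "0 < t"
    and X: "X \<in> poset_reps t" and X': "X' \<in> poset_reps t" and iso: "rep_iso R X X'"
  shows "(poset_step t R)\<^sup>*\<^sup>* X X'"
proof -
  have len: "length X = t" "length X' = t" using X X' by (auto simp: poset_reps_iff)
  define m where "m = dim_row (X!0)"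
  have m: "j < t \<Longrightarrow> dim_row (X!j) = m" for j
    unfolding m_def by (rule poset_reps_dim_row[OF X]) (simp add: len)
  obtain H H' g g' where inv: "mutually_inverse {..<dim_row (X!0)} {..<dim_row (X'!0)} H H'"
    "mutually_inverse (strip_index X) (strip_index X') g g'"
    and supp: "order_supported R g" "order_supported R g'"
    and eq: "\<And>p b. p < dim_row (X!0) \<Longrightarrow> b \<in> strip_index X' \<Longrightarrow>
       (\<Sum>a\<in>strip_index X. X!fst a $$ (p, snd a) * g a b) =
       (\<Sum>r<dim_row (X'!0). H p r * X'!fst b $$ (r, snd b))"
    using iso by (auto simp: rep_iso_def)
  have m': "dim_row (X'!0) = m" using mutually_inverse_eq[OF inv(1)] by (simp add: m_def)
  have m'': "j < t \<Longrightarrow> dim_row (X'!j) = m" for j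
    unfolding m'[symmetric] by (rule poset_reps_dim_row[OF X']) (simp add: len)
  note diag = mutually_inverse_diag_block[OF R inv(2) supp, unfolded len]
  have n: "dim_col (X'!j) = dim_col (X!j)" if "j < t" for j
    using mutually_inverse_eq[OF diag[OF that that]] by simp
  note eq = eq[unfolded m', folded m_def]
  note inv = inv[unfolded m', folded m_def]
  let ?H = "mat m m (\<lambda>(i, j). H i j)" and ?K = "mat m m (\<lambda>(i, j). H' i j)"
  have K: "elem_prod m ?K"
    using mutually_inverse_mat[OF inv(1)] mutually_inverse_mat[OF mutually_inverse_sym[OF inv(1)]]
    by (intro elem_prod_invertible[of _ _ ?H]) auto
  \<comment> \<open>The equation \<open>X g = H X'\<close> is solved as \<open>X' = H' X g\<close>:
    the rows are changed by the inverse of \<open>H\<close>, then the columns by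
    \<open>g\<close>.\<close>
  let ?Y = "map ((*) ?K) X"
  have Y: "?Y \<in> poset_reps t" using X by (intro poset_reps_map) auto
  have siY: "strip_index ?Y = strip_index X" by (auto simp: strip_index_def)
  have steps1: "(poset_step t R)\<^sup>*\<^sup>* X ?Y"
    by (rule poset_steps_mult_row[OF K X t]) (simp add: m_def)
  have steps2: "(poset_step t R)\<^sup>*\<^sup>* ?Y (map (\<lambda>j. mat (dim_row (?Y!j)) (dim_col (?Y!j))
    (\<lambda>(r, s). \<Sum>a\<in>strip_index ?Y. ?Y!fst a $$ (r, snd a) * g a (j, s))) [0..<t])"
    by (rule poset_steps_columns[OF R Y supp(1), of "\<lambda>j p q. g' (j, p) (j, q)"])
      (use diag n len in auto)
  have "map (\<lambda>j. mat (dim_row (?Y!j)) (dim_col (?Y!j))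
    (\<lambda>(r, s). \<Sum>a\<in>strip_index ?Y. ?Y!fst a $$ (r, snd a) * g a (j, s))) [0..<t] = X'"
  proof (rule nth_equalityI, goal_cases)
    case (2 j)
    then have j: "j < t" by simp
    have "mat m (dim_col (X!j)) (\<lambda>(r, s). \<Sum>a\<in>strip_index X. ?Y!fst a $$ (r, snd a) * g a (j, s)) = X'!j"
    proof (rule eq_matI, goal_cases)
      case (1 r s)
      then have rs: "r < m" "s < dim_col (X'!j)" "(j, s) \<in> strip_index X'"
        using n m'' j len by (auto simp: strip_index_def)
      have "(\<Sum>a\<in>strip_index X. ?Y!fst a $$ (r, snd a) * g a (j, s)) =
        (\<Sum>a\<in>strip_index X. \<Sum>u<m. H' r u * (X!fst a $$ (u, snd a) * g a (j, s)))"
      proof (rule sum.cong[OF refl])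
        fix a assume a: "a \<in> strip_index X"
        then have "?Y!fst a $$ (r, snd a) = (\<Sum>u<m. ?K $$ (r, u) * X!fst a $$ (u, snd a))"
          using len m rs by (subst nth_map, force simp: strip_index_def)
            (rule sum_mult_mat[of _ m _ _ "dim_col (X!fst a)"], auto simp: strip_index_def)
        then show "?Y!fst a $$ (r, snd a) * g a (j, s) =
          (\<Sum>u<m. H' r u * (X!fst a $$ (u, snd a) * g a (j, s)))"
          using rs by (simp add: sum_distrib_right mult.assoc)
      qed
      also have "\<dots> = (\<Sum>u<m. H' r u * (\<Sum>a\<in>strip_index X. X!fst a $$ (u, snd a) * g a (j, s)))"
        by (subst sum.swap) (simp add: sum_distrib_left)
      also have "\<dots> = (\<Sum>u<m. H' r u * (\<Sum>v<m. H u v * X'!j $$ (v, s)))"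
        using eq rs by simp
      also have "\<dots> = (\<Sum>v<m. (\<Sum>u<m. H' r u * H u v) * X'!j $$ (v, s))"
        by (simp add: sum_distrib_left sum_distrib_right mult.assoc) (rule sum.swap)
      also have "\<dots> = (\<Sum>v<m. of_bool (r = v) * X'!j $$ (v, s))"
        using inv(1) rs by (simp add: mutually_inverse_def)
      also have "\<dots> = X'!j $$ (r, s)" using rs by simp
      finally show ?case using 1 n m'' j rs by simp
    qed (use n m'' j in auto)
    then show ?case using j len by (simp add: siY)
  qed (use len in simp)
  with steps1 steps2 show ?thesis by simp
qed

section \<open>From one admissible transformation to an isomorphism of representations\<close>

lemma sum_if_eq_mult:
  fixes f :: "'i \<Rightarrow> 'a::comm_ring_1"
  assumes "finite I" "a \<in> I"
  shows "(\<Sum>b\<in>I. (if a = b then x else 0) * f b) = x * f a"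
    and "(\<Sum>b\<in>I. f b * (if b = a then x else 0)) = f a * x"
  using assms by (simp_all add: if_distrib[of "\<lambda>y. y * _"] if_distrib[of "(*) _"] cong: if_cong)

lemma mutually_inverse_id:
  assumes "finite I"
  shows "mutually_inverse I I (\<lambda>a b. of_bool (a = b)) (\<lambda>a b. of_bool (a = b))"
  using assms by (auto simp: mutually_inverse_def of_bool_def sum_if_eq_mult)

lemma mutually_inverse_scale:
  fixes c :: "'a::field"
  assumes "finite I" "c \<noteq> 0"
  shows "mutually_inverse I I (\<lambda>a b. if a = b then if b = i then c else 1 else 0)
    (\<lambda>a b. if a = b then if b = i then inverse c else 1 else 0)"
  using assms
  by (auto simp: mutually_inverse_def of_bool_def if_distrib[of "\<lambda>y. y * _"] sum.delta' cong: if_cong)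

lemma mutually_inverse_add:
  fixes c :: "'a::field"
  assumes I: "finite I" "i \<in> I" "j \<in> I" "i \<noteq> j"
  shows "mutually_inverse I I (\<lambda>a b. of_bool (a = b) + (if a = i \<and> b = j then c else 0))
    (\<lambda>a b. of_bool (a = b) + (if a = i \<and> b = j then - c else 0))"
proof -
  \<comment> \<open>Stated for every \<open>c\<close>, because the product in the other order is the
    instance at \<open>- c\<close>.\<close>
  have *: "(\<Sum>b\<in>I. (of_bool (a = b) + (if a = i \<and> b = j then c else 0)) *
     (of_bool (b = a') + (if b = i \<and> a' = j then - c else 0))) = of_bool (a = a')"
    if a: "a \<in> I" "a' \<in> I" for a a' and c :: 'a
  proof -
    have "(\<Sum>b\<in>I. (of_bool (a = b) + (if a = i \<and> b = j then c else 0)) *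
        (of_bool (b = a') + (if b = i \<and> a' = j then - c else 0))) =
      (\<Sum>b\<in>I. (if a = b then 1 else 0) * (of_bool (b = a') + (if b = i \<and> a' = j then - c else 0))) +
      (\<Sum>b\<in>I. (if j = b then of_bool (a = i) * c else 0) *
        (of_bool (b = a') + (if b = i \<and> a' = j then - c else 0)))"
      unfolding sum.distrib[symmetric] by (rule sum.cong) (auto simp: algebra_simps)
    also have "\<dots> = of_bool (a = a')"
      unfolding sum_if_eq_mult(1)[OF I(1) a(1)] sum_if_eq_mult(1)[OF I(1,3)] using I(4) by auto
    finally show ?thesis .
  qed
  from *[of _ _ c] *[of _ _ "- c"] show ?thesis
    unfolding mutually_inverse_def minus_minus by blast
qed

lemma mutually_inverse_swap:
  assumes I: "finite I" "i \<in> I" "j \<in> I"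
  shows "mutually_inverse I I (\<lambda>a b. of_bool (a = (if b = i then j else if b = j then i else b)))
    (\<lambda>a b. of_bool (a = (if b = i then j else if b = j then i else b)) :: 'a::comm_ring_1)"
proof -
  let ?f = "\<lambda>b. if b = i then j else if b = j then i else b"
  have "(\<Sum>b\<in>I. of_bool (a = ?f b) * of_bool (b = ?f a')) = (of_bool (a = a') :: 'a)"
    if "a \<in> I" "a' \<in> I" for a a'
  proof -
    have "?f a' \<in> I" using I that by auto
    then have "(\<Sum>b\<in>I. of_bool (a = ?f b) * of_bool (b = ?f a')) = (of_bool (a = ?f (?f a')) :: 'a)"
      using sum_if_eq_mult(2)[OF I(1), of "?f a'" "\<lambda>b. of_bool (a = ?f b)" "1::'a"]
      by (simp only: of_bool_def[of "_ = ?f a'"] mult_1_right)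
    also have "?f (?f a') = a'" by auto
    finally show ?thesis .
  qed
  then show ?thesis by (simp only: mutually_inverse_def) blast
qed

text \<open>\<open>order_supported\<close> speaks of all indices, also of those outside the strips.
  Setting \<open>g\<close> and \<open>g'\<close> to zero there changes none of the sums, so the
  order has to be checked inside the strips only.\<close>

lemma rep_isoI:
  assumes H: "mutually_inverse {..<dim_row (X!0)} {..<dim_row (X'!0)} H H'"
    and g: "mutually_inverse (strip_index X) (strip_index X') g g'"
    and supp: "\<And>a b. a \<in> strip_index X \<Longrightarrow> b \<in> strip_index X' \<Longrightarrow> g a b \<noteq> 0 \<Longrightarrow> (Suc (fst a), Suc (fst b)) \<in> R"
      "\<And>a b. a \<in> strip_index X' \<Longrightarrow> b \<in> strip_index X \<Longrightarrow> g' a b \<noteq> 0 \<Longrightarrow> (Suc (fst a), Suc (fst b)) \<in> R"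
    and eq: "\<And>p b. p < dim_row (X!0) \<Longrightarrow> b \<in> strip_index X' \<Longrightarrow>
       (\<Sum>a\<in>strip_index X. X!fst a $$ (p, snd a) * g a b) =
       (\<Sum>r<dim_row (X'!0). H p r * X'!fst b $$ (r, snd b))"
  shows "rep_iso R X X'"
proof -
  define h where "h = (\<lambda>a b. if a \<in> strip_index X \<and> b \<in> strip_index X' then g a b else 0)"
  define h' where "h' = (\<lambda>a b. if a \<in> strip_index X' \<and> b \<in> strip_index X then g' a b else 0)"
  have "mutually_inverse (strip_index X) (strip_index X') h h'"
    using g by (simp add: mutually_inverse_def h_def h'_def)
  moreover have "order_supported R h" "order_supported R h'"
    unfolding order_supported_def h_def h'_def using supp by auto
  moreover have "(\<Sum>a\<in>strip_index X. X!fst a $$ (p, snd a) * h a b) =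
       (\<Sum>r<dim_row (X'!0). H p r * X'!fst b $$ (r, snd b))"
    if "p < dim_row (X!0)" "b \<in> strip_index X'" for p b
    using eq[OF that] that by (simp add: h_def)
  ultimately show ?thesis using H unfolding rep_iso_def by blast
qed

lemma rep_iso_row:
  assumes R: "refl_on {1..t} R" and len: "length X = t"
    and row: "dim_row (X!0) = m" "\<And>i. i < t \<Longrightarrow> dim_row (X!i) = m"
    and f: "\<And>A. dim_row (f A) = dim_row A" "\<And>A. dim_col (f A) = dim_col A" and t: "0 < t"
    and H: "mutually_inverse {..<m} {..<m} H H'"
    and eq: "\<And>A p q. dim_row A = m \<Longrightarrow> p < m \<Longrightarrow> q < dim_col A \<Longrightarrow> A $$ (p, q) = (\<Sum>r<m. H p r * f A $$ (r, q))"
  shows "rep_iso R X (map f X)"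
proof (rule rep_isoI)
  have I: "strip_index (map f X) = strip_index X" using f by (auto simp: strip_index_def)
  have m': "dim_row (map f X!0) = m" using f row(1) t len by simp
  show "mutually_inverse {..<dim_row (X!0)} {..<dim_row (map f X!0)} H H'"
    unfolding m' row(1) by (rule H)
  show "mutually_inverse (strip_index X) (strip_index (map f X)) (\<lambda>a b. of_bool (a = b)) (\<lambda>a b. of_bool (a = b))"
    unfolding I by (rule mutually_inverse_id) simp
  show "(Suc (fst a), Suc (fst b)) \<in> R"
    if "a \<in> strip_index X" "b \<in> strip_index (map f X)" "of_bool (a = b) \<noteq> (0::'a)" for a b
    using that R len by (auto simp: strip_index_def refl_on_def)
  show "(Suc (fst a), Suc (fst b)) \<in> R"
    if "a \<in> strip_index (map f X)" "b \<in> strip_index X" "of_bool (a = b) \<noteq> (0::'a)" for a b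
    using that R len by (auto simp: strip_index_def refl_on_def)
  fix p b assume p: "p < dim_row (X!0)" and b: "b \<in> strip_index (map f X)"
  then have "(\<Sum>a\<in>strip_index X. X!fst a $$ (p, snd a) * of_bool (a = b)) = X!fst b $$ (p, snd b)"
    unfolding I of_bool_def by (simp only: sum_if_eq_mult(2) finite_strip_index mult_1_right)
  also have "\<dots> = (\<Sum>r<m. H p r * map f X!fst b $$ (r, snd b))"
    using p b row(2)[of "fst b"] row(1) len eq[of "X!fst b" p "snd b"]
    by (auto simp: strip_index_def f)
  finally show "(\<Sum>a\<in>strip_index X. X!fst a $$ (p, snd a) * of_bool (a = b)) =
    (\<Sum>r<dim_row (map f X!0). H p r * map f X!fst b $$ (r, snd b))" unfolding m' .
qed

lemma rep_iso_column:
  assumes len: "length X = t" and j: "j < t" and B: "dim_row B = dim_row (X!j)" "dim_col B = dim_col (X!j)"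
    and row: "\<And>i. i < t \<Longrightarrow> dim_row (X!i) = dim_row (X!0)"
    and g: "mutually_inverse (strip_index X) (strip_index X) g g'"
    and supp: "\<And>a b. a \<in> strip_index X \<Longrightarrow> b \<in> strip_index X \<Longrightarrow> g a b \<noteq> 0 \<Longrightarrow> (Suc (fst a), Suc (fst b)) \<in> R"
      "\<And>a b. a \<in> strip_index X \<Longrightarrow> b \<in> strip_index X \<Longrightarrow> g' a b \<noteq> 0 \<Longrightarrow> (Suc (fst a), Suc (fst b)) \<in> R"
    and eq: "\<And>p b. p < dim_row (X!0) \<Longrightarrow> b \<in> strip_index X \<Longrightarrow>
       (\<Sum>a\<in>strip_index X. X!fst a $$ (p, snd a) * g a b) = X[j := B]!fst b $$ (p, snd b)"
  shows "rep_iso R X (X[j := B])"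
proof (rule rep_isoI)
  let ?X = "X[j := B]"
  have "dim_col (?X!i) = dim_col (X!i)" for i
    using B(2) j len by (cases "i = j") simp_all
  then have I: "strip_index ?X = strip_index X" by (simp add: strip_index_def)
  have m': "dim_row (?X!0) = dim_row (X!0)" using B(1) j len by (cases "j = 0") auto
  show "mutually_inverse {..<dim_row (X!0)} {..<dim_row (?X!0)} (\<lambda>a b. of_bool (a = b)) (\<lambda>a b. of_bool (a = b))"
    unfolding m' by (rule mutually_inverse_id) simp
  show "mutually_inverse (strip_index X) (strip_index ?X) g g'"
    unfolding I by (rule g)
  show "(Suc (fst a), Suc (fst b)) \<in> R" if "a \<in> strip_index X" "b \<in> strip_index ?X" "g a b \<noteq> 0" for a b
    using that supp unfolding I by blast
  show "(Suc (fst a), Suc (fst b)) \<in> R" if "a \<in> strip_index ?X" "b \<in> strip_index X" "g' a b \<noteq> 0" for a b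
    using that supp unfolding I by blast
  fix p b assume p: "p < dim_row (X!0)" and b: "b \<in> strip_index ?X"
  have "(\<Sum>r<dim_row (X!0). of_bool (p = r) * ?X!fst b $$ (r, snd b)) = ?X!fst b $$ (p, snd b)"
    unfolding of_bool_def using p by (subst sum_if_eq_mult(1)) auto
  with eq[OF p] b show "(\<Sum>a\<in>strip_index X. X!fst a $$ (p, snd a) * g a b) =
       (\<Sum>r<dim_row (?X!0). of_bool (p = r) * ?X!fst b $$ (r, snd b))"
    unfolding I m' by simp
qed

lemma poset_step_reps:
  assumes "poset_step t R X X'"
  shows "X \<in> poset_reps t \<and> X' \<in> poset_reps t"
  using assms
proof (induction rule: poset_step.induct)
  case (row_swap As m p q)
  then show ?case by (auto simp: poset_reps_iff swap_rows_def)
next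
  case (row_scale As m p c)
  then show ?case by (auto simp: poset_reps_iff scale_row_def)
next
  case (row_add As m p q c)
  then show ?case by (auto simp: poset_reps_iff add_row_def)
qed (auto intro!: poset_reps_update simp: swap_cols_def scale_col_def add_col_def)

text \<open>A row operation \<open>E\<close> gives \<open>X' = E X\<close>, so \<open>g = 1\<close>
  and \<open>H\<close> is the inverse of \<open>E\<close>; this is why scalars occur inverted or
  negated. A column operation is itself the matrix \<open>g\<close>, with
  \<open>H = 1\<close>.\<close>

lemma step_imp_rep_iso:
  assumes R: "partial_order_on {1..t} R" and t: "0 < t" and step: "poset_step t R X X'"
  shows "rep_iso R X X'"
proof -
  have refl: "refl_on {1..t} R" using R by (simp add: partial_order_on_def preorder_on_def)
  have X: "X \<in> poset_reps t" using poset_step_reps[OF step] by simp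
  then have len: "length X = t" by (simp add: poset_reps_iff)
  define m where "m = dim_row (X!0)"
  have m: "dim_row (X!i) = m" if "i < t" for i
    unfolding m_def by (rule poset_reps_dim_row[OF X]) (simp add: len that)
  have row: "dim_row (X!0) = m" "\<And>i. i < t \<Longrightarrow> dim_row (X!i) = dim_row (X!0)"
    using m t by auto
  have refl': "(Suc (fst a), Suc (fst a)) \<in> R" if "a \<in> strip_index X" for a
    using that refl len by (auto simp: strip_index_def refl_on_def)
  have fin: "finite (strip_index X)" by simp
  from step show ?thesis
  proof cases
    case (row_swap m' p q)
    show ?thesis unfolding row_swap(1)
    proof (rule rep_iso_row[OF refl len row(1) m _ _ t])
      show "mutually_inverse {..<m} {..<m} (\<lambda>a b. of_bool (a = (if b = p then q else if b = q then p else b)))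
        (\<lambda>a b. of_bool (a = (if b = p then q else if b = q then p else b)) :: 'a)"
        using row_swap row(1) m by (intro mutually_inverse_swap) auto
      fix A :: "'a mat" and r s assume *: "dim_row A = m" "r < m" "s < dim_col A"
      let ?f = "\<lambda>b. if b = p then q else if b = q then p else b"
      have "(\<Sum>b<m. of_bool (r = ?f b) * swap_rows p q A $$ (b, s)) =
        (\<Sum>b<m. (if ?f r = b then 1 else 0) * swap_rows p q A $$ (b, s))"
        by (rule sum.cong) auto
      also have "\<dots> = swap_rows p q A $$ (?f r, s)"
        by (subst sum_if_eq_mult(1)) (use * row_swap row(1) m in auto)
      also have "\<dots> = A $$ (r, s)" using * row_swap row(1) m by (auto simp: swap_rows_def)
      finally show "A $$ (r, s) = (\<Sum>b<m. of_bool (r = ?f b) * swap_rows p q A $$ (b, s))" by simp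
    qed (auto simp: swap_rows_def)
  next
    case (row_scale m' p c)
    show ?thesis unfolding row_scale(1)
    proof (rule rep_iso_row[OF refl len row(1) m _ _ t])
      show "mutually_inverse {..<m} {..<m} (\<lambda>a b. if a = b then if b = p then inverse c else 1 else 0)
        (\<lambda>a b. if a = b then if b = p then c else 1 else 0)"
        using row_scale by (intro mutually_inverse_sym[OF mutually_inverse_scale]) auto
      fix A :: "'a mat" and r s assume *: "dim_row A = m" "r < m" "s < dim_col A"
      have "(\<Sum>b<m. (if r = b then if b = p then inverse c else 1 else 0) * scale_row p c A $$ (b, s)) =
        (\<Sum>b<m. (if r = b then if r = p then inverse c else 1 else 0) * scale_row p c A $$ (b, s))"
        by (rule sum.cong) auto
      also have "\<dots> = A $$ (r, s)"
        by (subst sum_if_eq_mult(1)) (use * row_scale in \<open>auto simp: scale_row_def\<close>)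
      finally show "A $$ (r, s) =
        (\<Sum>b<m. (if r = b then if b = p then inverse c else 1 else 0) * scale_row p c A $$ (b, s))" by simp
    qed (auto simp: scale_row_def)
  next
    case (row_add m' p q c)
    show ?thesis unfolding row_add(1)
    proof (rule rep_iso_row[OF refl len row(1) m _ _ t])
      show "mutually_inverse {..<m} {..<m} (\<lambda>a b. of_bool (a = b) + (if a = p \<and> b = q then - c else 0))
        (\<lambda>a b. of_bool (a = b) + (if a = p \<and> b = q then c else 0))"
        using row_add row(1) m by (intro mutually_inverse_sym[OF mutually_inverse_add]) auto
      fix A :: "'a mat" and r s assume *: "dim_row A = m" "r < m" "s < dim_col A"
      have "(\<Sum>b<m. (of_bool (r = b) + (if r = p \<and> b = q then - c else 0)) * add_row p q c A $$ (b, s)) =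
        (\<Sum>b<m. (if r = b then 1 else 0) * add_row p q c A $$ (b, s)) +
        (\<Sum>b<m. (if q = b then of_bool (r = p) * - c else 0) * add_row p q c A $$ (b, s))"
        unfolding sum.distrib[symmetric] by (rule sum.cong) (auto simp: algebra_simps)
      also have "\<dots> = A $$ (r, s)"
        by (subst (1 2) sum_if_eq_mult(1)) (use * row_add row(1) m in \<open>auto simp: add_row_def\<close>)
      finally show "A $$ (r, s) =
        (\<Sum>b<m. (of_bool (r = b) + (if r = p \<and> b = q then - c else 0)) * add_row p q c A $$ (b, s))" by simp
    qed (auto simp: add_row_def)
  next
    case (col_swap i p q)
    let ?j = "i - 1"
    have j: "?j < t" using col_swap by auto
    have pq: "(?j, p) \<in> strip_index X" "(?j, q) \<in> strip_index X"
      using col_swap j len by (auto simp: strip_index_def)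
    let ?f = "\<lambda>b. if b = (?j, p) then (?j, q) else if b = (?j, q) then (?j, p) else b"
    show ?thesis unfolding col_swap(1)
    proof (rule rep_iso_column[OF len j _ _ row(2) mutually_inverse_swap[OF fin pq]])
      fix r b assume *: "r < dim_row (X!0)" "b \<in> strip_index X"
      have "(\<Sum>a\<in>strip_index X. X!fst a $$ (r, snd a) * of_bool (a = ?f b)) =
        (X!fst (?f b) $$ (r, snd (?f b)) :: 'a)"
        unfolding of_bool_def by (subst sum_if_eq_mult(2)[OF fin]) (use * pq in auto)
      also have "\<dots> = X[?j := swap_cols p q (X!?j)]!fst b $$ (r, snd b)"
        using * len j col_swap row(1) m by (cases b) (auto simp: swap_cols_def strip_index_def nth_list_update)
      finally show "(\<Sum>a\<in>strip_index X. X!fst a $$ (r, snd a) * of_bool (a = ?f b)) =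
        X[?j := swap_cols p q (X!?j)]!fst b $$ (r, snd b)" .
    qed (use refl' pq in \<open>auto simp: swap_cols_def split: if_splits\<close>)
  next
    case (col_scale i p c)
    let ?j = "i - 1"
    have j: "?j < t" using col_scale by auto
    show ?thesis unfolding col_scale(1)
    proof (rule rep_iso_column[OF len j _ _ row(2) mutually_inverse_scale[OF fin, of c "(?j, p)"]])
      fix r b assume *: "r < dim_row (X!0)" "b \<in> strip_index X"
      have "(\<Sum>a\<in>strip_index X. X!fst a $$ (r, snd a) * (if a = b then if b = (?j, p) then c else 1 else 0)) =
        X!fst b $$ (r, snd b) * (if b = (?j, p) then c else 1)"
        by (subst sum_if_eq_mult(2)[OF fin]) (use * in auto)
      also have "\<dots> = X[?j := scale_col p c (X!?j)]!fst b $$ (r, snd b)"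
        using * len j row(1) m by (cases b) (auto simp: scale_col_def strip_index_def nth_list_update)
      finally show "(\<Sum>a\<in>strip_index X. X!fst a $$ (r, snd a) * (if a = b then if b = (?j, p) then c else 1 else 0)) =
        X[?j := scale_col p c (X!?j)]!fst b $$ (r, snd b)" .
    qed (use refl' col_scale in \<open>auto simp: scale_col_def split: if_splits\<close>)
  next
    case (col_add i p q c)
    let ?j = "i - 1"
    have j: "?j < t" using col_add by auto
    have pq: "(?j, p) \<in> strip_index X" "(?j, q) \<in> strip_index X"
      using col_add j len by (auto simp: strip_index_def)
    have ne: "(?j, q) \<noteq> (?j, p)" using col_add by auto
    show ?thesis unfolding col_add(1)
    proof (rule rep_iso_column[OF len j _ _ row(2) mutually_inverse_add[OF fin pq(2,1) ne, of c]])
      fix r b assume *: "r < dim_row (X!0)" "b \<in> strip_index X"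
      have "(\<Sum>a\<in>strip_index X. X!fst a $$ (r, snd a) * (of_bool (a = b) + (if a = (?j, q) \<and> b = (?j, p) then c else 0))) =
        (\<Sum>a\<in>strip_index X. X!fst a $$ (r, snd a) * (if a = b then 1 else 0)) +
        (\<Sum>a\<in>strip_index X. X!fst a $$ (r, snd a) * (if a = (?j, q) then of_bool (b = (?j, p)) * c else 0))"
        unfolding sum.distrib[symmetric] by (rule sum.cong) (auto simp: algebra_simps)
      also have "\<dots> = X!fst b $$ (r, snd b) + X!?j $$ (r, q) * (of_bool (b = (?j, p)) * c)"
        by (subst (1 2) sum_if_eq_mult(2)[OF fin]) (use * pq in auto)
      also have "\<dots> = X[?j := add_col p q c (X!?j)]!fst b $$ (r, snd b)"
        using * len j row(1) m by (cases b) (auto simp: add_col_def strip_index_def nth_list_update)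
      finally show "(\<Sum>a\<in>strip_index X. X!fst a $$ (r, snd a) * (of_bool (a = b) + (if a = (?j, q) \<and> b = (?j, p) then c else 0))) =
        X[?j := add_col p q c (X!?j)]!fst b $$ (r, snd b)" .
    qed (use refl' pq in \<open>auto simp: add_col_def split: if_splits\<close>)
  next
    case (strip_add i j q p c)
    let ?i = "i - 1" and ?j = "j - 1"
    let ?B = "mat (dim_row (X!?j)) (dim_col (X!?j))
        (\<lambda>(r,s). if s = p then X!?j $$ (r,s) + c * X!?i $$ (r,q) else X!?j $$ (r,s))"
    have ij: "?i < t" "?j < t" "Suc ?i = i" "Suc ?j = j" using strip_add by auto
    have pq: "(?i, q) \<in> strip_index X" "(?j, p) \<in> strip_index X"
      using strip_add ij len by (auto simp: strip_index_def)
    have ne: "(?i, q) \<noteq> (?j, p)" using strip_add ij by auto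
    show ?thesis unfolding strip_add(1)
    proof (rule rep_iso_column[OF len ij(2) _ _ row(2) mutually_inverse_add[OF fin pq ne, of c]])
      fix r b assume *: "r < dim_row (X!0)" "b \<in> strip_index X"
      have "(\<Sum>a\<in>strip_index X. X!fst a $$ (r, snd a) * (of_bool (a = b) + (if a = (?i, q) \<and> b = (?j, p) then c else 0))) =
        (\<Sum>a\<in>strip_index X. X!fst a $$ (r, snd a) * (if a = b then 1 else 0)) +
        (\<Sum>a\<in>strip_index X. X!fst a $$ (r, snd a) * (if a = (?i, q) then of_bool (b = (?j, p)) * c else 0))"
        unfolding sum.distrib[symmetric] by (rule sum.cong) (auto simp: algebra_simps)
      also have "\<dots> = X!fst b $$ (r, snd b) + X!?i $$ (r, q) * (of_bool (b = (?j, p)) * c)"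
        by (subst (1 2) sum_if_eq_mult(2)[OF fin]) (use * pq in auto)
      also have "\<dots> = X[?j := ?B]!fst b $$ (r, snd b)"
        using * len ij row(1) m by (cases b) (auto simp: strip_index_def nth_list_update)
      finally show "(\<Sum>a\<in>strip_index X. X!fst a $$ (r, snd a) * (of_bool (a = b) + (if a = (?i, q) \<and> b = (?j, p) then c else 0))) =
        X[?j := ?B]!fst b $$ (r, snd b)" .
    qed (use refl' pq strip_add ij in \<open>auto split: if_splits\<close>)
  qed
qed

section \<open>Block matrices and matrices of polynomials\<close>

text \<open>The basis of a block matrix as a list of pairs (block, position), in the order in which
  \<open>block\<close> counts its offsets.\<close>

definition block_index :: "'l list \<Rightarrow> ('l \<Rightarrow> nat) \<Rightarrow> ('l \<times> nat) list" where
  "block_index L d = concat (map (\<lambda>l. map (Pair l) [0..<d l]) L)"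

lemma length_block_index [simp]: "length (block_index L d) = sum_list (map d L)"
  by (induction L) (simp_all add: block_index_def)

lemma set_block_index: "set (block_index L d) = (SIGMA l:set L. {..<d l})"
  by (auto simp: block_index_def)

lemma distinct_block_index: "distinct L \<Longrightarrow> distinct (block_index L d)"
  by (induction L) (auto simp: block_index_def distinct_map inj_on_def)

lemma block_index_less:
  fixes d :: "'l \<Rightarrow> nat"
  assumes "r < length L" "k < d (L!r)"
  shows "sum_list (take r (map d L)) + k < sum_list (map d L)"
  using assms
proof (induction L arbitrary: r)
  case (Cons l L)
  then show ?case
    by (cases r) (use Cons.IH[of "r - 1"] in auto)
qed simp

lemma nth_block_index:
  assumes "r < length L" "k < d (L!r)"
  shows "block_index L d ! (sum_list (take r (map d L)) + k) = (L!r, k)"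
  using assms
proof (induction L arbitrary: r)
  case (Cons l L)
  then show ?case by (cases r) (auto simp: block_index_def nth_append)
qed simp

text \<open>A matrix described by entries on named basis vectors. Products become sums over sets of
  names, so that computations with entries do not depend on the enumeration.\<close>

definition fun_mat :: "'i list \<Rightarrow> 'j list \<Rightarrow> ('i \<Rightarrow> 'j \<Rightarrow> 'a) \<Rightarrow> 'a mat" where
  "fun_mat xs ys F = mat (length xs) (length ys) (\<lambda>(i, j). F (xs!i) (ys!j))"

lemma fun_mat_carrier [simp]: "fun_mat xs ys F \<in> carrier_mat (length xs) (length ys)"
  by (simp add: fun_mat_def)

lemma fun_mat_eq_iff:
  "fun_mat xs ys F = fun_mat xs ys G \<longleftrightarrow> (\<forall>a\<in>set xs. \<forall>b\<in>set ys. F a b = G a b)"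
proof
  assume eq: "fun_mat xs ys F = fun_mat xs ys G"
  have "F (xs!i) (ys!j) = G (xs!i) (ys!j)" if "i < length xs" "j < length ys" for i j
    using arg_cong[OF eq, of "\<lambda>A. A $$ (i, j)"] that by (simp add: fun_mat_def)
  then show "\<forall>a\<in>set xs. \<forall>b\<in>set ys. F a b = G a b" by (auto simp: in_set_conv_nth)
qed (auto simp: fun_mat_def intro!: eq_matI)

lemma fun_mat_one:
  assumes "distinct xs"
  shows "1\<^sub>m (length xs) = fun_mat xs xs (\<lambda>a b. of_bool (a = b))"
  using assms by (auto simp: fun_mat_def nth_eq_iff_index_eq)

lemma fun_mat_add: "fun_mat xs ys F + fun_mat xs ys G = fun_mat xs ys (\<lambda>a b. F a b + G a b)"
  by (auto simp: fun_mat_def)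

lemma fun_mat_mult:
  fixes F :: "'i \<Rightarrow> 'j \<Rightarrow> 'a::semiring_0"
  assumes "distinct ys"
  shows "fun_mat xs ys F * fun_mat ys zs G = fun_mat xs zs (\<lambda>a c. \<Sum>b\<in>set ys. F a b * G b c)"
proof (rule eq_matI, goal_cases)
  case (1 i j)
  then have "(fun_mat xs ys F * fun_mat ys zs G) $$ (i, j) = (\<Sum>l<length ys. F (xs!i) (ys!l) * G (ys!l) (zs!j))"
    by (auto simp: fun_mat_def scalar_prod_def atLeast0LessThan)
  also have "\<dots> = (\<Sum>b\<in>set ys. F (xs!i) b * G b (zs!j))"
    using sum.reindex_bij_betw[OF bij_betw_nth[OF assms refl refl]] .
  finally show ?case using 1 by (simp add: fun_mat_def)
qed (simp_all add: fun_mat_def)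

lemma the_inv_into_nth:
  assumes "distinct zs" "i < length zs"
  shows "the_inv_into {..<length zs} (nth zs) (zs!i) = i"
  using assms by (intro the_inv_into_f_f) (auto simp: inj_on_nth)

text \<open>Similarity supplies arbitrary matrices \<open>S\<close> and \<open>S'\<close>; this
  gives names to their rows and columns, so that their entries can be compared label by
  label.\<close>

lemma fun_mat_exhaust:
  assumes "distinct xs" "distinct ys" "A \<in> carrier_mat (length xs) (length ys)"
  obtains F where "A = fun_mat xs ys F"
proof
  show "A = fun_mat xs ys (\<lambda>a b. A $$
      (the_inv_into {..<length xs} (nth xs) a, the_inv_into {..<length ys} (nth ys) b))"
    using assms by (intro eq_matI) (auto simp: fun_mat_def the_inv_into_nth)
qed

section \<open>Polynomial matrices with entries 0, 1 and single variables\<close>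

datatype entry = Zero | One | Var nat

primrec entry_poly :: "entry \<Rightarrow> 'a::zero_neq_one ncpoly" where
  "entry_poly Zero = (\<lambda>w. 0)"
| "entry_poly One = (\<lambda>w. of_bool (w = []))"
| "entry_poly (Var i) = (\<lambda>w. of_bool (w = [i]))"

text \<open>\<open>Zero\<close> fits every size, so all control over block sizes has to come from
  \<open>One\<close> and \<open>Var\<close>.\<close>

primrec entry_ok :: "'a mat list \<Rightarrow> entry \<Rightarrow> nat \<Rightarrow> nat \<Rightarrow> bool" where
  "entry_ok X Zero r c = True"
| "entry_ok X One r c = (r = c)"
| "entry_ok X (Var i) r c = (i < length X \<and> dim_row (X!i) = r \<and> dim_col (X!i) = c)"

primrec entry_val :: "'a::zero_neq_one mat list \<Rightarrow> entry \<Rightarrow> nat \<Rightarrow> nat \<Rightarrow> 'a" where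
  "entry_val X Zero p q = 0"
| "entry_val X One p q = of_bool (p = q)"
| "entry_val X (Var i) p q = X!i $$ (p, q)"

lemma ncpoly_supp_zero [simp]: "ncpoly_supp (\<lambda>w. 0) = {}"
  by (simp add: ncpoly_supp_def)

lemma ncpoly_supp_monom [simp]: "ncpoly_supp (\<lambda>w. of_bool (w = u) :: 'a::zero_neq_one) = {u}"
  by (auto simp: ncpoly_supp_def)

lemma ncpoly_ok_entry_poly:
  fixes X :: "'a::zero_neq_one mat list"
  shows "ncpoly_ok X (entry_poly e) r c \<longleftrightarrow> entry_ok X e r c"
  by (cases e) (auto simp: ncpoly_ok_def)

lemma ncpoly_val_entry_poly:
  fixes X :: "'a::field mat list"
  assumes "entry_ok X e r c"
  shows "ncpoly_val X (entry_poly e) r c = mat r c (\<lambda>(p, q). entry_val X e p q)"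
  using assms by (cases e) (auto simp: ncpoly_val_def intro!: eq_matI)

definition poly_mat :: "'l list \<Rightarrow> ('l \<Rightarrow> 'l \<Rightarrow> entry) \<Rightarrow> 'a::zero_neq_one ncpoly_mat" where
  "poly_mat L T = (length L, length L, \<lambda>r s. entry_poly (T (L!r) (L!s)))"

definition poly_mat_val :: "'l list \<Rightarrow> ('l \<Rightarrow> nat) \<Rightarrow> ('l \<Rightarrow> 'l \<Rightarrow> entry) \<Rightarrow> 'a::zero_neq_one mat list \<Rightarrow> 'a mat" where
  "poly_mat_val L d T X = fun_mat (block_index L d) (block_index L d)
     (\<lambda>a b. entry_val X (T (fst a) (fst b)) (snd a) (snd b))"

lemma is_ncpoly_mat_poly_mat: "is_ncpoly_mat (poly_mat L T :: 'a::zero_neq_one ncpoly_mat)"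
proof -
  have "finite (ncpoly_supp (entry_poly e :: 'a ncpoly))" for e by (cases e) simp_all
  then show ?thesis by (simp add: is_ncpoly_mat_def poly_mat_def)
qed

lemma block_poly_mat_val:
  assumes "r < length L" "s < length L"
  shows "block (poly_mat_val L d T X) (map d L) (map d L) r s =
    mat (d (L!r)) (d (L!s)) (\<lambda>(p, q). entry_val X (T (L!r) (L!s)) p q)"
  using assms
  by (intro eq_matI)
    (auto simp: block_def poly_mat_val_def fun_mat_def block_index_less nth_block_index)

lemma subst_mat_poly_mat_val:
  fixes X :: "'a::field mat list"
  assumes "\<And>a b. a \<in> set L \<Longrightarrow> b \<in> set L \<Longrightarrow> entry_ok X (T a b) (d a) (d b)"
  shows "subst_mat (poly_mat L T) X (poly_mat_val L d T X)"
  unfolding subst_mat_def poly_mat_def prod.case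
proof (intro exI[of _ "map d L"] conjI allI impI)
  show "poly_mat_val L d T X \<in> carrier_mat (sum_list (map d L)) (sum_list (map d L))"
    using fun_mat_carrier[of "block_index L d" "block_index L d"] by (simp add: poly_mat_val_def)
qed (simp_all add: assms ncpoly_ok_entry_poly ncpoly_val_entry_poly block_poly_mat_val)

text \<open>\<open>h\<close> and \<open>w\<close> are candidate heights and widths. Once the entries
  admit only the sizes \<open>d\<close>, every block of \<open>M\<close> is known, and the blocks
  cover \<open>M\<close>.\<close>

lemma subst_mat_poly_mat_unique:
  fixes X :: "'a::field mat list"
  assumes L: "distinct L"
    and pinned: "\<And>h w a. (\<And>a b. a \<in> set L \<Longrightarrow> b \<in> set L \<Longrightarrow> entry_ok X (T a b) (h a) (w b)) \<Longrightarrow>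
      a \<in> set L \<Longrightarrow> h a = d a \<and> w a = d a"
    and M: "subst_mat (poly_mat L T) X M"
  shows "M = poly_mat_val L d T X"
proof -
  obtain hs ws where len: "length hs = length L" "length ws = length L"
    and c: "M \<in> carrier_mat (sum_list hs) (sum_list ws)"
    and ok: "\<And>r s. r < length L \<Longrightarrow> s < length L \<Longrightarrow> entry_ok X (T (L!r) (L!s)) (hs!r) (ws!s)"
    and block: "\<And>r s. r < length L \<Longrightarrow> s < length L \<Longrightarrow>
      block M hs ws r s = mat (hs!r) (ws!s) (\<lambda>(p, q). entry_val X (T (L!r) (L!s)) p q)"
    using M unfolding subst_mat_def poly_mat_def prod.case
    by (auto simp: ncpoly_ok_entry_poly ncpoly_val_entry_poly)
  \<comment> \<open>\<open>subst_mat\<close> lists the sizes by position, while the premise speaks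
    of labels. \<open>?pos\<close> translates, using that \<open>L\<close> is distinct.\<close>
  let ?pos = "the_inv_into {..<length L} (nth L)"
  have pos: "?pos (L!r) = r" if "r < length L" for r
    using that L by (intro the_inv_into_nth)
  have "hs!(?pos a) = d a \<and> ws!(?pos a) = d a" if "a \<in> set L" for a
    by (rule pinned[OF _ that, of "\<lambda>a. hs!(?pos a)" "\<lambda>a. ws!(?pos a)"])
      (auto simp: in_set_conv_nth pos ok)
  from this[OF nth_mem] have "hs = map d L" "ws = map d L"
    using len by (auto intro!: nth_equalityI simp: pos)
  note c = c[unfolded this] and block = block[unfolded this]
  let ?xs = "block_index L d"
  show ?thesis
  proof (rule eq_matI)
    fix i j assume "i < dim_row (poly_mat_val L d T X)" "j < dim_col (poly_mat_val L d T X)"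
    then have ij: "i < length ?xs" "j < length ?xs" by (auto simp: poly_mat_val_def fun_mat_def)
    \<comment> \<open>Every flat index lies in some block: its name in \<open>?xs\<close> says in
      which one, and distinctness of \<open>?xs\<close> leads from the name back to the
      position.\<close>
    have pos: "\<exists>r k. r < length L \<and> k < d (L!r) \<and> i = sum_list (take r (map d L)) + k"
      if i: "i < length ?xs" for i
    proof -
      have "?xs!i \<in> set ?xs" using i by simp
      then obtain l k where lk: "?xs!i = (l, k)" "l \<in> set L" "k < d l" by (auto simp: set_block_index)
      then obtain r where r: "r < length L" "l = L!r" by (auto simp: in_set_conv_nth)
      then have "?xs!(sum_list (take r (map d L)) + k) = ?xs!i" using lk by (simp add: nth_block_index)
      moreover have "sum_list (take r (map d L)) + k < length ?xs"
        using block_index_less[of r L k d] r lk by simp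
      ultimately have "i = sum_list (take r (map d L)) + k"
        using nth_eq_iff_index_eq[OF distinct_block_index[OF L, of d]] i by blast
      then show ?thesis using r lk by blast
    qed
    obtain r k s l where r: "r < length L" "k < d (L!r)" "i = sum_list (take r (map d L)) + k"
      and s: "s < length L" "l < d (L!s)" "j = sum_list (take s (map d L)) + l"
      using pos[OF ij(1)] pos[OF ij(2)] by blast
    have "M $$ (i, j) = block M (map d L) (map d L) r s $$ (k, l)"
      using r s by (simp add: block_def)
    also have "\<dots> = block (poly_mat_val L d T X) (map d L) (map d L) r s $$ (k, l)"
      using r s by (simp add: block block_poly_mat_val)
    also have "\<dots> = poly_mat_val L d T X $$ (i, j)"
      using r s by (simp add: block_def)
    finally show "M $$ (i, j) = poly_mat_val L d T X $$ (i, j)" .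
  qed (use c in \<open>auto simp: poly_mat_val_def fun_mat_def\<close>)
qed

section \<open>The pair attached to a representation\<close>

lemma mat_add_left_cancel:
  fixes A :: "'a::cancel_semigroup_add mat"
  assumes "A + B = A + C" "A \<in> carrier_mat m n" "B \<in> carrier_mat m n" "C \<in> carrier_mat m n"
  shows "B = C"
proof (rule eq_matI)
  fix i j assume ij: "i < dim_row C" "j < dim_col C"
  have "(A + B) $$ (i, j) = (A + C) $$ (i, j)" using assms(1) by simp
  then show "B $$ (i, j) = C $$ (i, j)" using ij assms(2-) by auto
qed (use assms in auto)

text \<open>\<open>S\<close> intertwines \<open>J + N\<close>, hence also its square. Cancelling the
  square in the second relation leaves \<open>J\<close>, and cancelling \<open>J\<close> in the
  first leaves \<open>N\<close>. Only sums are cancelled; nothing is divided by.\<close>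

lemma intertwine_iff:
  fixes J N J' N' S :: "'a::comm_ring_1 mat"
  assumes J: "J \<in> carrier_mat n n" and N: "N \<in> carrier_mat n n"
    and J': "J' \<in> carrier_mat n n" and N': "N' \<in> carrier_mat n n" and S: "S \<in> carrier_mat n n"
  shows "((1\<^sub>m n + (J + N)) * S = S * (1\<^sub>m n + (J' + N')) \<and>
      (1\<^sub>m n + (J + (J + N) * (J + N))) * S = S * (1\<^sub>m n + (J' + (J' + N') * (J' + N')))) \<longleftrightarrow>
    (J * S = S * J' \<and> N * S = S * N')"
proof -
  define W W' where "W = J + N" and "W' = J' + N'"
  have W: "W \<in> carrier_mat n n" "W' \<in> carrier_mat n n" using assms by (auto simp: W_def W'_def)
  have one: "(1\<^sub>m n + A) * S = S * (1\<^sub>m n + B) \<longleftrightarrow> A * S = S * B"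
    if A: "A \<in> carrier_mat n n" and B: "B \<in> carrier_mat n n" for A B
  proof -
    have eq: "(1\<^sub>m n + A) * S = S + A * S" "S * (1\<^sub>m n + B) = S + S * B"
      using add_mult_distrib_mat[of "1\<^sub>m n" n n A S n] mult_add_distrib_mat[of S n n "1\<^sub>m n" n B] A B S
      by auto
    show ?thesis
      unfolding eq using mat_add_left_cancel[of S "A * S" "S * B" n n] A B S by auto
  qed
  have sum: "(J + A) * S = J * S + A * S" "S * (J' + A) = S * J' + S * A" if "A \<in> carrier_mat n n" for A
    using add_mult_distrib_mat[OF J that S] mult_add_distrib_mat[OF S J' that] by auto
  have square: "W * W * S = S * (W' * W')" if "W * S = S * W'"
  proof -
    note assoc = assoc_mult_mat[of _ n n _ n _ n]
    have "W * W * S = W * (S * W')" using W S by (simp add: assoc that)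
    also have "\<dots> = W * S * W'" using W S by (intro assoc[symmetric])
    also have "\<dots> = S * (W' * W')" unfolding that using W S by (intro assoc)
    finally show ?thesis .
  qed
  have com: "A + B = B + A" if "A \<in> carrier_mat n n" "B \<in> carrier_mat n n" for A B :: "'a mat"
    using that by (rule comm_add_mat)
  have "W * S = S * W' \<and> (J + W * W) * S = S * (J' + W' * W') \<longleftrightarrow> J * S = S * J' \<and> N * S = S * N'"
  proof
    assume *: "W * S = S * W' \<and> (J + W * W) * S = S * (J' + W' * W')"
    then have "J * S + W * W * S = S * J' + S * (W' * W')"
      using sum(1)[of "W * W"] sum(2)[of "W' * W'"] W by simp
    then have "S * (W' * W') + J * S = S * (W' * W') + S * J'"
      using square * com[of "S * (W' * W')" "J * S"] com[of "S * (W' * W')" "S * J'"] W S J J' by simp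
    then have 1: "J * S = S * J'"
      using W S J J' by (intro mat_add_left_cancel[of "S * (W' * W')" "J * S" "S * J'" n n]) auto
    have "S * J' + N * S = S * J' + S * N'"
      using * sum(1)[OF N] sum(2)[OF N'] 1 by (simp add: W_def W'_def)
    then have "N * S = S * N'"
      using S J' N N' by (intro mat_add_left_cancel[of "S * J'" "N * S" "S * N'" n n]) auto
    with 1 show "J * S = S * J' \<and> N * S = S * N'" by simp
  next
    assume *: "J * S = S * J' \<and> N * S = S * N'"
    then have 1: "W * S = S * W'"
      using sum(1)[OF N] sum(2)[OF N'] by (simp add: W_def W'_def)
    then show "W * S = S * W' \<and> (J + W * W) * S = S * (J' + W' * W')"
      using * square sum(1)[of "W * W"] sum(2)[of "W' * W'"] W by simp
  qed
  then show ?thesis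
    using one[of W W'] one[of "J + W * W" "J' + W' * W'"] W J J' unfolding W_def W'_def by auto
qed

text \<open>
  \<open>Top\<close> is the block of \<open>V\<close>, \<open>Chain x i\<close> the summand with index \<open>i + 1\<close> of the copy \<open>x\<close> of \<open>W\<close>, and
  \<open>Sub x i\<close> the same summand of the subspace belonging to the poset element \<open>x + 1\<close>.
\<close>

datatype label = Top | Chain nat nat | Sub nat nat

text \<open>Why \<open>t + 2\<close> copies: copies 1 to \<open>t\<close> receive the subspaces,
  \<open>Sub x\<close> entering copy \<open>x + 1\<close>. Copy 0 lies before copy 1, where
  \<open>A\<close> starts, so that \<open>N J\<close> contains \<open>A\<close>. Copy
  \<open>t + 1\<close> makes \<open>J\<close> injective on copies 0 to \<open>t\<close> and keeps
  \<open>J N\<close> nonzero on a nonzero last subspace.\<close>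

definition labels :: "nat \<Rightarrow> (nat \<times> nat) set \<Rightarrow> label set" where
  "labels t R = {Top} \<union> {Chain x i | x i. x < t + 2 \<and> i < t} \<union>
     {Sub x i | x i. x < t \<and> i < t \<and> (Suc i, Suc x) \<in> R}"

lemma labels_simps [simp]:
  "Top \<in> labels t R"
  "Chain x i \<in> labels t R \<longleftrightarrow> x < t + 2 \<and> i < t"
  "Sub x i \<in> labels t R \<longleftrightarrow> x < t \<and> i < t \<and> (Suc i, Suc x) \<in> R"
  by (auto simp: labels_def)

lemma finite_labels [simp]: "finite (labels t R)"
proof (rule finite_subset)
  show "labels t R \<subseteq> {Top} \<union> case_prod Chain ` ({..<t + 2} \<times> {..<t}) \<union> case_prod Sub ` ({..<t} \<times> {..<t})"
    by (auto simp: labels_def)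
qed auto

fun label_dim :: "'a mat list \<Rightarrow> label \<Rightarrow> nat" where
  "label_dim X Top = dim_row (X!0)"
| "label_dim X (Chain x i) = dim_col (X!i)"
| "label_dim X (Sub x i) = dim_col (X!i)"

text \<open>Columns are sources and rows are targets: \<open>J\<close> sends copy \<open>y\<close>
  to copy \<open>y + 1\<close>, while \<open>N\<close> sends subspace \<open>y\<close> into copy
  \<open>y + 1\<close> and copy 1 to \<open>Top\<close>.\<close>

fun entryP :: "label \<Rightarrow> label \<Rightarrow> entry" where
  "entryP Top Top = One"
| "entryP Top (Chain y j) = (if y = 1 then Var j else Zero)"
| "entryP (Chain x i) (Chain y j) = (if i = j \<and> (x = y \<or> x = Suc y) then One else Zero)"
| "entryP (Chain x i) (Sub y j) = (if i = j \<and> x = Suc y then One else Zero)"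
| "entryP (Sub x i) (Sub y j) = (if i = j \<and> x = y then One else Zero)"
| "entryP _ _ = Zero"

text \<open>Beyond \<open>1 + J\<close>, the square contributes \<open>J J\<close> from copy
  \<open>y\<close> to copy \<open>y + 2\<close>, \<open>J N\<close> from subspace \<open>y\<close>
  to copy \<open>y + 2\<close>, \<open>N J\<close> from copy 0 to \<open>Top\<close> and
  \<open>N N\<close> from subspace 0 to \<open>Top\<close>. These positions do not overlap, so each
  entry is still 0, 1 or one variable.\<close>

fun entryQ :: "label \<Rightarrow> label \<Rightarrow> entry" where
  "entryQ Top Top = One"
| "entryQ Top (Chain y j) = (if y = 0 then Var j else Zero)"
| "entryQ Top (Sub y j) = (if y = 0 then Var j else Zero)"
| "entryQ (Chain x i) (Chain y j) =
    (if i = j \<and> (x = y \<or> x = Suc y \<or> x = Suc (Suc y)) then One else Zero)"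
| "entryQ (Chain x i) (Sub y j) = (if i = j \<and> x = Suc (Suc y) then One else Zero)"
| "entryQ (Sub x i) (Sub y j) = (if i = j \<and> x = y then One else Zero)"
| "entryQ _ _ = Zero"

text \<open>\<open>shift\<close> and \<open>glue X\<close> are the entries of the matrices \<open>J\<close> and \<open>N\<close>.\<close>

fun shift :: "label \<times> nat \<Rightarrow> label \<times> nat \<Rightarrow> 'a::zero_neq_one" where
  "shift (Chain x i, p) (Chain y j, q) = of_bool (x = Suc y \<and> i = j \<and> p = q)"
| "shift _ _ = 0"

fun glue :: "'a::zero_neq_one mat list \<Rightarrow> label \<times> nat \<Rightarrow> label \<times> nat \<Rightarrow> 'a" where
  "glue X (Top, p) (Chain y j, q) = (if y = 1 then X!j $$ (p, q) else 0)"
| "glue X (Chain x i, p) (Sub y j, q) = of_bool (x = Suc y \<and> i = j \<and> p = q)"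
| "glue X _ _ = 0"

definition basis :: "nat \<Rightarrow> (nat \<times> nat) set \<Rightarrow> 'a mat list \<Rightarrow> (label \<times> nat) set" where
  "basis t R X = (SIGMA l:labels t R. {..<label_dim X l})"

lemma finite_basis [simp]: "finite (basis t R X)"
  by (simp add: basis_def)

lemma mem_basis [simp]:
  "(Top, p) \<in> basis t R X \<longleftrightarrow> p < dim_row (X!0)"
  "(Chain x i, p) \<in> basis t R X \<longleftrightarrow> x < t + 2 \<and> i < t \<and> p < dim_col (X!i)"
  "(Sub x i, p) \<in> basis t R X \<longleftrightarrow> x < t \<and> i < t \<and> (Suc i, Suc x) \<in> R \<and> p < dim_col (X!i)"
  by (auto simp: basis_def)

lemma sum_basis_Top:
  fixes f :: "label \<times> nat \<Rightarrow> 'a::comm_monoid_add"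
  assumes "\<And>x i p. f (Chain x i, p) = 0" "\<And>x i p. f (Sub x i, p) = 0"
  shows "sum f (basis t R X) = (\<Sum>r<dim_row (X!0). f (Top, r))"
proof -
  have "f b = 0" if "b \<in> basis t R X - Pair Top ` {..<dim_row (X!0)}" for b
    using that assms by (cases b; cases "fst b") auto
  then have "sum f (basis t R X) = sum f (Pair Top ` {..<dim_row (X!0)})"
    by (intro sum.mono_neutral_right) auto
  then show ?thesis by (simp add: sum.reindex inj_on_def)
qed

lemma sum_basis_Chain:
  fixes f :: "label \<times> nat \<Rightarrow> 'a::comm_monoid_add"
  assumes "\<And>p. f (Top, p) = 0" "\<And>y i p. y \<noteq> x \<Longrightarrow> f (Chain y i, p) = 0" "\<And>x i p. f (Sub x i, p) = 0"
    and "x < t + 2" "length X = t"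
  shows "sum f (basis t R X) = (\<Sum>a\<in>strip_index X. f (Chain x (fst a), snd a))"
proof -
  let ?h = "\<lambda>a. (Chain x (fst a), snd a)"
  have "f b = 0" if "b \<in> basis t R X - ?h ` strip_index X" for b
  proof (cases b)
    case (Pair l p)
    show ?thesis
    proof (cases l)
      case (Chain y i)
      have "y \<noteq> x"
      proof
        assume "y = x"
        then have "b = ?h (i, p)" "(i, p) \<in> strip_index X"
          using that Pair Chain assms by (auto simp: strip_index_def)
        then show False using that by blast
      qed
      then show ?thesis using assms Pair Chain by simp
    qed (use assms Pair in auto)
  qed
  then have "sum f (basis t R X) = sum f (?h ` strip_index X)"
    using assms(4,5) by (intro sum.mono_neutral_right) (auto simp: strip_index_def)
  then show ?thesis by (simp add: sum.reindex inj_on_def prod_eq_iff)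
qed

lemma sum_basis_Sub:
  fixes f :: "label \<times> nat \<Rightarrow> 'a::comm_monoid_add"
  assumes "\<And>p. f (Top, p) = 0" "\<And>y i p. f (Chain y i, p) = 0" "\<And>y i p. y \<noteq> x \<Longrightarrow> f (Sub y i, p) = 0"
    and "x < t" "length X = t"
  shows "sum f (basis t R X) =
    (\<Sum>a\<in>{a \<in> strip_index X. (Suc (fst a), Suc x) \<in> R}. f (Sub x (fst a), snd a))"
proof -
  let ?h = "\<lambda>a. (Sub x (fst a), snd a)" and ?A = "{a \<in> strip_index X. (Suc (fst a), Suc x) \<in> R}"
  have "f b = 0" if "b \<in> basis t R X - ?h ` ?A" for b
  proof (cases b)
    case (Pair l p)
    show ?thesis
    proof (cases l)
      case (Sub y i)
      have "y \<noteq> x"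
      proof
        assume "y = x"
        then have "b = ?h (i, p)" "(i, p) \<in> ?A"
          using that Pair Sub assms by (auto simp: strip_index_def)
        then show False using that by blast
      qed
      then show ?thesis using assms Pair Sub by simp
    qed (use assms Pair in auto)
  qed
  then have "sum f (basis t R X) = sum f (?h ` ?A)"
    using assms(4,5) by (intro sum.mono_neutral_right) (auto simp: strip_index_def)
  then show ?thesis by (simp add: sum.reindex inj_on_def prod_eq_iff)
qed

lemma shift_left:
  fixes f :: "label \<times> nat \<Rightarrow> 'a::comm_ring_1"
  shows "(\<Sum>b\<in>basis t R X. shift (Top, p) b * f b) = 0"
    and "(\<Sum>b\<in>basis t R X. shift (Sub x i, p) b * f b) = 0"
    and "(\<Sum>b\<in>basis t R X. shift (Chain 0 i, p) b * f b) = 0"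
    and "(Chain (Suc x) i, p) \<in> basis t R X \<Longrightarrow>
      (\<Sum>b\<in>basis t R X. shift (Chain (Suc x) i, p) b * f b) = f (Chain x i, p)"
proof -
  have "shift (Chain 0 i, p) b = (0::'a)" for b by (cases b; cases "fst b") auto
  then show "(\<Sum>b\<in>basis t R X. shift (Chain 0 i, p) b * f b) = 0" by simp
  assume a: "(Chain (Suc x) i, p) \<in> basis t R X"
  have "shift (Chain (Suc x) i, p) b = (if (Chain x i, p) = b then 1::'a else 0)" for b
    by (cases b; cases "fst b") auto
  then show "(\<Sum>b\<in>basis t R X. shift (Chain (Suc x) i, p) b * f b) = f (Chain x i, p)"
    using a by (simp add: sum_if_eq_mult(1))
qed simp_all

text \<open>The last copy \<open>t + 1\<close> has no successor, hence the conditional.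
  \<open>shift_left\<close> has its corresponding break at copy 0.\<close>

lemma shift_right:
  fixes f :: "label \<times> nat \<Rightarrow> 'a::comm_ring_1"
  shows "(\<Sum>a\<in>basis t R X. f a * shift a (Top, q)) = 0"
    and "(\<Sum>a\<in>basis t R X. f a * shift a (Sub y j, q)) = 0"
    and "(Chain y j, q) \<in> basis t R X \<Longrightarrow> (\<Sum>a\<in>basis t R X. f a * shift a (Chain y j, q)) =
      (if y < Suc t then f (Chain (Suc y) j, q) else 0)"
proof -
  have "shift b (Top, q) = (0::'a)" "shift b (Sub y j, q) = (0::'a)" for b
    by (cases b; cases "fst b"; auto)+
  then show "(\<Sum>a\<in>basis t R X. f a * shift a (Top, q)) = 0"
    "(\<Sum>a\<in>basis t R X. f a * shift a (Sub y j, q)) = 0" by simp_all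
  assume a: "(Chain y j, q) \<in> basis t R X"
  have s: "shift b (Chain y j, q) = (if b = (Chain (Suc y) j, q) then 1::'a else 0)" for b
    by (cases b; cases "fst b") auto
  show "(\<Sum>a\<in>basis t R X. f a * shift a (Chain y j, q)) = (if y < Suc t then f (Chain (Suc y) j, q) else 0)"
  proof (cases "y < Suc t")
    case True
    then show ?thesis using a by (simp add: s sum_if_eq_mult(2))
  next
    case False
    then have "b \<in> basis t R X \<Longrightarrow> f b * shift b (Chain y j, q) = 0" for b by (auto simp: s)
    then show ?thesis using False by simp
  qed
qed

text \<open>Row \<open>Chain (Suc x) i\<close> meets \<open>Sub x i\<close> only if
  \<open>x < t\<close> and \<open>i + 1\<close> lies below \<open>x + 1\<close> in the order. This
  conditional is how the order becomes visible in products with \<open>N\<close>.\<close>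

lemma glue_left:
  fixes f :: "label \<times> nat \<Rightarrow> 'a::comm_ring_1"
  assumes "length X = t" "0 < t"
  shows "(\<Sum>b\<in>basis t R X. glue X (Top, p) b * f b) =
      (\<Sum>a\<in>strip_index X. X!fst a $$ (p, snd a) * f (Chain 1 (fst a), snd a))"
    and "(\<Sum>b\<in>basis t R X. glue X (Sub x i, p) b * f b) = 0"
    and "(\<Sum>b\<in>basis t R X. glue X (Chain 0 i, p) b * f b) = 0"
    and "(Chain (Suc x) i, p) \<in> basis t R X \<Longrightarrow>
      (\<Sum>b\<in>basis t R X. glue X (Chain (Suc x) i, p) b * f b) =
      (if Sub x i \<in> labels t R then f (Sub x i, p) else 0)"
proof -
  show "(\<Sum>b\<in>basis t R X. glue X (Top, p) b * f b) =
      (\<Sum>a\<in>strip_index X. X!fst a $$ (p, snd a) * f (Chain 1 (fst a), snd a))"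
    using assms by (subst sum_basis_Chain[of _ 1]) auto
  have "glue X (Chain 0 i, p) b = (0::'a)" for b by (cases b; cases "fst b") auto
  then show "(\<Sum>b\<in>basis t R X. glue X (Chain 0 i, p) b * f b) = 0" by simp
  assume a: "(Chain (Suc x) i, p) \<in> basis t R X"
  have s: "glue X (Chain (Suc x) i, p) b = (if (Sub x i, p) = b then 1::'a else 0)" for b
    by (cases b; cases "fst b") auto
  show "(\<Sum>b\<in>basis t R X. glue X (Chain (Suc x) i, p) b * f b) =
      (if Sub x i \<in> labels t R then f (Sub x i, p) else 0)"
  proof (cases "Sub x i \<in> labels t R")
    case True
    then show ?thesis using a by (simp add: s sum_if_eq_mult(1))
  next
    case False
    then have "b \<in> basis t R X \<Longrightarrow> glue X (Chain (Suc x) i, p) b * f b = 0" for b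
      using a by (auto simp: s)
    then show ?thesis using False by (simp del: labels_simps)
  qed
qed simp

lemma glue_right:
  fixes f :: "label \<times> nat \<Rightarrow> 'a::comm_ring_1"
  shows "(\<Sum>a\<in>basis t R X. f a * glue X a (Top, q)) = 0"
    and "(\<Sum>a\<in>basis t R X. f a * glue X a (Chain y j, q)) =
      (if y = 1 then \<Sum>r<dim_row (X!0). f (Top, r) * X!j $$ (r, q) else 0)"
    and "(Sub y j, q) \<in> basis t R X \<Longrightarrow>
      (\<Sum>a\<in>basis t R X. f a * glue X a (Sub y j, q)) = f (Chain (Suc y) j, q)"
proof -
  have "glue X b (Top, q) = (0::'a)" for b by (cases b; cases "fst b") auto
  then show "(\<Sum>a\<in>basis t R X. f a * glue X a (Top, q)) = 0" by simp
  show "(\<Sum>a\<in>basis t R X. f a * glue X a (Chain y j, q)) =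
      (if y = 1 then \<Sum>r<dim_row (X!0). f (Top, r) * X!j $$ (r, q) else 0)"
    by (subst sum_basis_Top) auto
  assume a: "(Sub y j, q) \<in> basis t R X"
  have s: "glue X b (Sub y j, q) = (if b = (Chain (Suc y) j, q) then 1::'a else 0)" for b
    by (cases b; cases "fst b") auto
  show "(\<Sum>a\<in>basis t R X. f a * glue X a (Sub y j, q)) = f (Chain (Suc y) j, q)"
    using a by (simp add: s sum_if_eq_mult(2))
qed

lemma entryP_val:
  fixes X :: "'a::field mat list"
  shows "entry_val X (entryP (fst a) (fst b)) (snd a) (snd b) = of_bool (a = b) + (shift a b + glue X a b)"
  by (cases a; cases b; cases "fst a"; cases "fst b") auto

lemma entryQ_val:
  fixes X :: "'a::field mat list"
  assumes X: "length X = t" "0 < t" and a: "a \<in> basis t R X" and b: "b \<in> basis t R X"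
  shows "entry_val X (entryQ (fst a) (fst b)) (snd a) (snd b) =
    of_bool (a = b) + (shift a b + (\<Sum>c\<in>basis t R X. (shift a c + glue X a c) * (shift c b + glue X c b)))"
proof -
  obtain l p l' q where ab: "a = (l, p)" "b = (l', q)" by (metis surj_pair)
  have "(\<Sum>c\<in>basis t R X. (shift a c + glue X a c) * (shift c b + glue X c b)) =
    (\<Sum>c\<in>basis t R X. shift a c * (shift c b + glue X c b)) +
    (\<Sum>c\<in>basis t R X. glue X a c * (shift c b + glue X c b))" (is "_ = ?s + ?g")
    by (simp add: distrib_right sum.distrib)
  moreover have "entry_val X (entryQ l l') p q = of_bool (a = b) + (shift a b + (?s + ?g))"
  proof (cases l)
    case Top
    have g: "?g = (\<Sum>c\<in>strip_index X. X!fst c $$ (p, snd c) *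
        (shift (Chain 1 (fst c), snd c) b + glue X (Chain 1 (fst c), snd c) b))"
      unfolding ab Top by (rule glue_left(1)[OF X])
    show ?thesis
    proof (cases l')
      case Top': Top
      then show ?thesis using Top unfolding g by (simp add: ab shift_left)
    next
      case (Chain y j)
      have "?g = (\<Sum>c\<in>strip_index X. X!fst c $$ (p, snd c) * (if c = (j, q) then of_bool (y = 0) else 0))"
        unfolding g by (rule sum.cong) (auto simp: ab Chain)
      also have "\<dots> = X!j $$ (p, q) * of_bool (y = 0)"
        using b ab Chain X by (subst sum_if_eq_mult(2)) (auto simp: strip_index_def)
      finally show ?thesis using Top Chain by (simp add: ab shift_left)
    next
      case (Sub y j)
      have "?g = (\<Sum>c\<in>strip_index X. X!fst c $$ (p, snd c) * (if c = (j, q) then of_bool (y = 0) else 0))"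
        unfolding g by (rule sum.cong) (auto simp: ab Sub)
      also have "\<dots> = X!j $$ (p, q) * of_bool (y = 0)"
        using b ab Sub X by (subst sum_if_eq_mult(2)) (auto simp: strip_index_def)
      finally show ?thesis using Top Sub by (simp add: ab shift_left)
    qed
  next
    case (Chain x i)
    show ?thesis
    proof (cases x)
      case 0
      then show ?thesis unfolding ab Chain 0 shift_left glue_left[OF X] by (cases l') auto
    next
      case (Suc x')
      have "(Chain (Suc x') i, p) \<in> basis t R X" using a ab Chain Suc by simp
      then have *: "?s = shift (Chain x' i, p) b + glue X (Chain x' i, p) b"
        "?g = (if Sub x' i \<in> labels t R then shift (Sub x' i, p) b + glue X (Sub x' i, p) b else 0)"
        unfolding ab Chain Suc by (simp_all only: shift_left(4) glue_left(4)[OF X])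
      show ?thesis unfolding * unfolding ab Chain Suc
      proof (cases l', goal_cases)
        case 1
        then show ?case by simp
      next
        case (2 y j)
        then show ?case
          by (cases "i = j \<and> p = q"; cases "Suc x' = y"; cases "x' = y"; cases "x' = Suc y"; simp)
      next
        case (3 y j)
        then show ?case by (cases "x' = y"; cases "x' = Suc y"; simp)
      qed
    qed
  next
    case (Sub x i)
    then show ?thesis using X by (cases l') (auto simp: ab shift_left glue_left)
  qed
  ultimately show ?thesis by (simp add: ab)
qed

section \<open>Intertwining matrices\<close>

text \<open>\<open>J F = F J'\<close> and \<open>N F = F N'\<close>. So \<open>F\<close> maps the
  space of \<open>X'\<close> to that of \<open>X\<close>, sending kernels and images of
  \<open>J'\<close> and \<open>N'\<close> into those of \<open>J\<close> and
  \<open>N\<close>.\<close>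

definition intertwines ::
  "nat \<Rightarrow> (nat \<times> nat) set \<Rightarrow> 'a::field mat list \<Rightarrow> 'a mat list \<Rightarrow>
    (label \<times> nat \<Rightarrow> label \<times> nat \<Rightarrow> 'a) \<Rightarrow> bool" where
  "intertwines t R X X' F \<longleftrightarrow> (\<forall>a\<in>basis t R X. \<forall>c\<in>basis t R X'.
     (\<Sum>b\<in>basis t R X. shift a b * F b c) = (\<Sum>b\<in>basis t R X'. F a b * shift b c) \<and>
     (\<Sum>b\<in>basis t R X. glue X a b * F b c) = (\<Sum>b\<in>basis t R X'. F a b * glue X' b c))"

text \<open>The image of \<open>J'\<close> goes into that of \<open>J\<close>, which avoids
  \<open>Top\<close> and copy 0. The kernel of \<open>J'\<close>, containing \<open>Top\<close> and
  the subspaces, goes into that of \<open>J\<close>, which has no component in copies 0 to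
  \<open>t\<close>. Also \<open>Top\<close> lies in the kernel of \<open>N'\<close>, and vectors in
  the kernel of \<open>N\<close> have no component in the subspaces.\<close>

lemma intertwines_zero:
  assumes F: "intertwines t R X X' F" and t: "0 < t" "length X = t" "length X' = t"
  shows "\<lbrakk>(Chain 1 i, p) \<in> basis t R X; (Chain y j, q) \<in> basis t R X'; 1 < y\<rbrakk> \<Longrightarrow>
      F (Chain 1 i, p) (Chain y j, q) = 0"
    and "\<lbrakk>(Chain 0 i, p) \<in> basis t R X; (Chain (Suc y) j, q) \<in> basis t R X'\<rbrakk> \<Longrightarrow>
      F (Chain 0 i, p) (Chain (Suc y) j, q) = 0"
    and "\<lbrakk>(Chain x i, p) \<in> basis t R X; (Top, q) \<in> basis t R X'; x \<le> t\<rbrakk> \<Longrightarrow>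
      F (Chain x i, p) (Top, q) = 0"
    and "\<lbrakk>(Chain x i, p) \<in> basis t R X; (Sub y j, q) \<in> basis t R X'; x \<le> t\<rbrakk> \<Longrightarrow>
      F (Chain x i, p) (Sub y j, q) = 0"
    and "\<lbrakk>(Top, p) \<in> basis t R X; (Chain (Suc y) j, q) \<in> basis t R X'\<rbrakk> \<Longrightarrow>
      F (Top, p) (Chain (Suc y) j, q) = 0"
    and "\<lbrakk>(Sub x i, p) \<in> basis t R X; (Top, q) \<in> basis t R X'\<rbrakk> \<Longrightarrow>
      F (Sub x i, p) (Top, q) = 0"
    and "\<lbrakk>(Chain 1 i, p) \<in> basis t R X; (Chain 1 j, q) \<in> basis t R X';
        F (Chain 1 i, p) (Chain 1 j, q) \<noteq> 0; (Suc j, Suc j) \<in> R\<rbrakk> \<Longrightarrow> (Suc i, Suc j) \<in> R"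
    and "\<lbrakk>(Top, p) \<in> basis t R X; (Chain 1 j, q) \<in> basis t R X'\<rbrakk> \<Longrightarrow>
      (\<Sum>a\<in>strip_index X. X!fst a $$ (p, snd a) * F (Chain 1 (fst a), snd a) (Chain 1 j, q)) =
      (\<Sum>r<dim_row (X'!0). F (Top, p) (Top, r) * X'!j $$ (r, q))"
proof -
  have S: "(\<Sum>b\<in>basis t R X. shift a b * F b c) = (\<Sum>b\<in>basis t R X'. F a b * shift b c)"
    and G: "(\<Sum>b\<in>basis t R X. glue X a b * F b c) = (\<Sum>b\<in>basis t R X'. F a b * glue X' b c)"
    if "a \<in> basis t R X" "c \<in> basis t R X'" for a c
    using F that by (auto simp: intertwines_def)
  have toeplitz: "F (Chain (Suc x) i, p) (Chain (Suc y) j, q) = F (Chain x i, p) (Chain y j, q)"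
    if "(Chain (Suc x) i, p) \<in> basis t R X" "(Chain (Suc y) j, q) \<in> basis t R X'" for x y i j p q
    using S[of "(Chain (Suc x) i, p)" "(Chain y j, q)"] that
    by (simp add: shift_left shift_right)
  show upper: "F (Chain 0 i, p) (Chain (Suc y) j, q) = 0"
    if "(Chain 0 i, p) \<in> basis t R X" "(Chain (Suc y) j, q) \<in> basis t R X'" for y i j p q
    using S[of "(Chain 0 i, p)" "(Chain y j, q)"] that
    by (simp add: shift_left shift_right)
  \<comment> \<open>One Toeplitz step leads from copies \<open>(1, y)\<close> to
    \<open>(0, y - 1)\<close>, where \<open>y - 1\<close> is positive.\<close>
  show "F (Chain 1 i, p) (Chain y j, q) = 0"
    if "(Chain 1 i, p) \<in> basis t R X" "(Chain y j, q) \<in> basis t R X'" "1 < y" for y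
    using toeplitz[of 0 i p "y - 1" j q] upper[of i p "y - 2" j q] that
    by (simp add: numeral_2_eq_2 Suc_diff_Suc less_imp_diff_less)
  show "F (Chain x i, p) (Top, q) = 0"
    if "(Chain x i, p) \<in> basis t R X" "(Top, q) \<in> basis t R X'" "x \<le> t"
    using S[of "(Chain (Suc x) i, p)" "(Top, q)"] that
    by (simp add: shift_left shift_right)
  show "F (Chain x i, p) (Sub y j, q) = 0"
    if "(Chain x i, p) \<in> basis t R X" "(Sub y j, q) \<in> basis t R X'" "x \<le> t"
    using S[of "(Chain (Suc x) i, p)" "(Sub y j, q)"] that
    by (simp add: shift_left shift_right)
  show "F (Top, p) (Chain (Suc y) j, q) = 0"
    if "(Top, p) \<in> basis t R X" "(Chain (Suc y) j, q) \<in> basis t R X'"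
    using S[of "(Top, p)" "(Chain y j, q)"] that
    by (simp add: shift_left shift_right)
  show "F (Sub x i, p) (Top, q) = 0"
    if "(Sub x i, p) \<in> basis t R X" "(Top, q) \<in> basis t R X'"
    using G[of "(Chain (Suc x) i, p)" "(Top, q)"] that
    by (simp add: glue_left[OF t(2,1)] glue_right)
  \<comment> \<open>The test is made on the subspace of \<open>j\<close> itself, which contains
    summand \<open>j\<close> by reflexivity. If it lacks summand \<open>i\<close>, the entry
    vanishes in copy \<open>j + 1\<close>, and the Toeplitz property carries this to copy 1.\<close>
  show "(Suc i, Suc j) \<in> R"
    if that': "(Chain 1 i, p) \<in> basis t R X" "(Chain 1 j, q) \<in> basis t R X'"
      "F (Chain 1 i, p) (Chain 1 j, q) \<noteq> 0" "(Suc j, Suc j) \<in> R"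
  proof (rule ccontr)
    assume "(Suc i, Suc j) \<notin> R"
    then have zero: "F (Chain (Suc j) i, p) (Chain (Suc j) j, q) = 0"
      using G[of "(Chain (Suc j) i, p)" "(Sub j j, q)"] that' t
      by (simp add: glue_left[OF t(2,1)] glue_right)
    have "F (Chain (Suc x) i, p) (Chain (Suc x) j, q) = F (Chain 1 i, p) (Chain 1 j, q)"
      if "x \<le> t" for x
      using that
    proof (induction x)
      case (Suc x)
      then show ?case
        using toeplitz[of "Suc x" i p "Suc x" j q] that'(1,2) by simp
    qed simp
    from this[of j] show False using zero that' t by simp
  qed
  show "(\<Sum>a\<in>strip_index X. X!fst a $$ (p, snd a) * F (Chain 1 (fst a), snd a) (Chain 1 j, q)) =
      (\<Sum>r<dim_row (X'!0). F (Top, p) (Top, r) * X'!j $$ (r, q))"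
    if "(Top, p) \<in> basis t R X" "(Chain 1 j, q) \<in> basis t R X'"
    using G[OF that] unfolding glue_left(1)[OF t(2,1)] glue_right(2) by simp
qed

text \<open>\<open>H\<close> is the \<open>Top\<close> block of \<open>F\<close>, and
  \<open>g\<close> its block on copy 1, where \<open>A\<close> starts. For every intermediate basis
  vector outside the block, the factor from \<open>F\<close> or the factor from \<open>G\<close>
  vanishes, so these blocks of \<open>F\<close> and \<open>G\<close> are mutually inverse on their
  own.\<close>

lemma rep_iso_of_intertwines:
  assumes R: "partial_order_on {1..t} R" and t: "0 < t" "length X = t" "length X' = t"
    and inv: "mutually_inverse (basis t R X) (basis t R X') F G"
    and F: "intertwines t R X X' F" and G: "intertwines t R X' X G"
  shows "rep_iso R X X'"
proof -
  have refl: "(Suc j, Suc j) \<in> R" if "j < t" for j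
    using R that by (auto simp: partial_order_on_def preorder_on_def refl_on_def)
  let ?g = "\<lambda>F a b. F (Chain 1 (fst a), snd a) (Chain 1 (fst b), snd b)"
  have mem: "(Chain x (fst a), snd a) \<in> basis t R Y" if "a \<in> strip_index Y" "length Y = t" "x < t + 2"
    for a x and Y :: "'a mat list"
    using that by (auto simp: strip_index_def)
  have H: "(\<Sum>r<dim_row (Y'!0). F (Top, p) (Top, r) * G (Top, r) (Top, q)) =
      (\<Sum>b\<in>basis t R Y'. F (Top, p) b * G b (Top, q))"
    if F: "intertwines t R Y Y' F" and G: "intertwines t R Y' Y G"
      and Y: "length Y = t" "length Y' = t" and pq: "(Top, p) \<in> basis t R Y" "(Top, q) \<in> basis t R Y"
    for F G p q and Y Y' :: "'a mat list"
  proof -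
    have "F (Top, p) b * G b (Top, q) = 0" if b: "b \<in> basis t R Y' - Pair Top ` {..<dim_row (Y'!0)}" for b
    proof (cases b)
      case (Pair l r)
      show ?thesis
      proof (cases l)
        case Top
        then show ?thesis using b Pair by auto
      next
        case (Chain y j)
        show ?thesis
        proof (cases y)
          case 0
          then show ?thesis using intertwines_zero(3)[OF G t(1) Y(2,1), of 0 j r q] b pq Pair Chain by simp
        next
          case (Suc y')
          then show ?thesis using intertwines_zero(5)[OF F t(1) Y, of p y' j r] b pq Pair Chain by simp
        qed
      next
        case (Sub y j)
        then show ?thesis using intertwines_zero(6)[OF G t(1) Y(2,1), of y j r q] b pq Pair by simp
      qed
    qed
    then have "(\<Sum>b\<in>basis t R Y'. F (Top, p) b * G b (Top, q)) =
      (\<Sum>b\<in>Pair Top ` {..<dim_row (Y'!0)}. F (Top, p) b * G b (Top, q))"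
      by (intro sum.mono_neutral_right) auto
    then show ?thesis by (simp add: sum.reindex inj_on_def)
  qed
  have g: "(\<Sum>b\<in>strip_index Y'. ?g F a b * ?g G b c) =
      (\<Sum>b\<in>basis t R Y'. F (Chain 1 (fst a), snd a) b * G b (Chain 1 (fst c), snd c))"
    if F: "intertwines t R Y Y' F" and G: "intertwines t R Y' Y G"
      and Y: "length Y = t" "length Y' = t" and ac: "a \<in> strip_index Y" "c \<in> strip_index Y"
    for F G a c and Y Y' :: "'a mat list"
  proof -
    let ?h = "\<lambda>b. (Chain 1 (fst b), snd b)"
    have a: "?h a \<in> basis t R Y" and c: "?h c \<in> basis t R Y" using mem[OF _ Y(1), of _ 1] ac by auto
    have "F (?h a) b * G b (?h c) = 0" if b: "b \<in> basis t R Y' - ?h ` strip_index Y'" for b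
    proof (cases b)
      case (Pair l r)
      show ?thesis
      proof (cases l)
        case Top
        then show ?thesis using intertwines_zero(3)[OF F t(1) Y a, of r] b t(1) Pair by simp
      next
        case (Chain y j)
        have "y \<noteq> 1"
        proof
          assume "y = 1"
          then have "b = ?h (j, r)" "(j, r) \<in> strip_index Y'"
            using b Y Pair Chain by (auto simp: strip_index_def)
          then show False using b by blast
        qed
        then consider "y = 0" | "1 < y" by linarith
        then show ?thesis
        proof cases
          case 1
          then show ?thesis
            using intertwines_zero(2)[OF G t(1) Y(2,1), of j r 0 "fst c" "snd c"] b c Pair Chain by simp
        next
          case 2
          then show ?thesis using intertwines_zero(1)[OF F t(1) Y a, of y j r] b Pair Chain by simp
        qed
      next
        case (Sub y j)
        then show ?thesis using intertwines_zero(4)[OF F t(1) Y a, of y j r] b t(1) Pair by simp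
      qed
    qed
    then have "(\<Sum>b\<in>basis t R Y'. F (?h a) b * G b (?h c)) =
      (\<Sum>b\<in>?h ` strip_index Y'. F (?h a) b * G b (?h c))"
      using mem[OF _ Y(2), of _ 1] by (intro sum.mono_neutral_right) auto
    then show ?thesis by (simp add: sum.reindex inj_on_def prod_eq_iff)
  qed
  show ?thesis
  proof (rule rep_isoI)
    show "mutually_inverse {..<dim_row (X!0)} {..<dim_row (X'!0)}
        (\<lambda>p q. F (Top, p) (Top, q)) (\<lambda>p q. G (Top, p) (Top, q))"
      using inv H[OF F G t(2,3)] H[OF G F t(3,2)] by (simp add: mutually_inverse_def)
    show "mutually_inverse (strip_index X) (strip_index X') (?g F) (?g G)"
      unfolding mutually_inverse_def
    proof (intro conjI ballI)
      fix a c assume ac: "a \<in> strip_index X" "c \<in> strip_index X"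
      then show "(\<Sum>b\<in>strip_index X'. ?g F a b * ?g G b c) = of_bool (a = c)"
        using inv mem[OF _ t(2), of _ 1] unfolding g[OF F G t(2,3) ac] mutually_inverse_def
        by (simp del: mem_basis add: prod_eq_iff)
    next
      fix a c assume ac: "a \<in> strip_index X'" "c \<in> strip_index X'"
      then show "(\<Sum>b\<in>strip_index X. ?g G a b * ?g F b c) = of_bool (a = c)"
        using inv mem[OF _ t(3), of _ 1] unfolding g[OF G F t(3,2) ac] mutually_inverse_def
        by (simp del: mem_basis add: prod_eq_iff)
    qed
    show "(Suc (fst a), Suc (fst b)) \<in> R" if "a \<in> strip_index X" "b \<in> strip_index X'" "?g F a b \<noteq> 0" for a b
      using that t by (intro intertwines_zero(7)[OF F t mem mem that(3) refl]) (auto simp: strip_index_def)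
    show "(Suc (fst a), Suc (fst b)) \<in> R" if "a \<in> strip_index X'" "b \<in> strip_index X" "?g G a b \<noteq> 0" for a b
      using that t by (intro intertwines_zero(7)[OF G t(1,3,2) mem mem that(3) refl]) (auto simp: strip_index_def)
    fix p b assume "p < dim_row (X!0)" "b \<in> strip_index X'"
    then show "(\<Sum>a\<in>strip_index X. X!fst a $$ (p, snd a) * ?g F a b) =
       (\<Sum>r<dim_row (X'!0). F (Top, p) (Top, r) * X'!fst b $$ (r, snd b))"
      using t by (intro intertwines_zero(8)[OF F t]) (auto simp: strip_index_def)
  qed
qed

section \<open>From an isomorphism of representations to an invertible intertwiner\<close>

fun assemble :: "(nat \<Rightarrow> nat \<Rightarrow> 'a::zero) \<Rightarrow> (nat \<times> nat \<Rightarrow> nat \<times> nat \<Rightarrow> 'a) \<Rightarrow>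
    label \<times> nat \<Rightarrow> label \<times> nat \<Rightarrow> 'a" where
  "assemble H g (Top, p) (Top, q) = H p q"
| "assemble H g (Chain x i, p) (Chain y j, q) = (if x = y then g (i, p) (j, q) else 0)"
| "assemble H g (Sub x i, p) (Sub y j, q) = (if x = y then g (i, p) (j, q) else 0)"
| "assemble H g _ _ = 0"

lemma assemble_left:
  fixes H :: "nat \<Rightarrow> nat \<Rightarrow> 'a::comm_ring_1"
  assumes "length X = t"
  shows "(\<Sum>b\<in>basis t R X. assemble H g (Top, p) b * f b) = (\<Sum>r<dim_row (X!0). H p r * f (Top, r))"
    and "x < t + 2 \<Longrightarrow> (\<Sum>b\<in>basis t R X. assemble H g (Chain x i, p) b * f b) =
      (\<Sum>b\<in>strip_index X. g (i, p) b * f (Chain x (fst b), snd b))"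
    and "x < t \<Longrightarrow> (\<Sum>b\<in>basis t R X. assemble H g (Sub x i, p) b * f b) =
      (\<Sum>b\<in>{b \<in> strip_index X. (Suc (fst b), Suc x) \<in> R}. g (i, p) b * f (Sub x (fst b), snd b))"
  using assms by (subst sum_basis_Top sum_basis_Chain[of _ x] sum_basis_Sub[of _ x]; simp)+

text \<open>On \<open>Top\<close> and the copies of \<open>W\<close> this is \<open>H H' = 1\<close>
  and \<open>g g' = 1\<close>. On a subspace the sum runs only over strips below \<open>x\<close>;
  the missing terms vanish because, by transitivity, \<open>g'\<close> leads from strips below
  \<open>x\<close> only to strips below \<open>x\<close>.\<close>

lemma assemble_half_inverse:
  assumes R: "partial_order_on {1..t} R" and t: "length X = t" "length X' = t"
    and H: "mutually_inverse {..<dim_row (X!0)} {..<dim_row (X'!0)} H H'"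
    and g: "mutually_inverse (strip_index X) (strip_index X') g g'"
    and supp: "order_supported R g'"
    and ac: "a \<in> basis t R X" "c \<in> basis t R X"
  shows "(\<Sum>b\<in>basis t R X'. assemble H g a b * assemble H' g' b c) = (of_bool (a = c) :: 'a::field)"
proof -
  have trans: "trans R" using R by (auto simp: partial_order_on_def preorder_on_def)
  obtain l p m q where eq: "a = (l, p)" "c = (m, q)" by (metis surj_pair)
  show ?thesis
  proof (cases l)
    case Top
    then show ?thesis
      using ac H unfolding eq Top assemble_left(1)[OF t(2)]
      by (cases m) (auto simp: mutually_inverse_def)
  next
    case (Chain x i)
    then have x: "x < t + 2" using ac eq by simp
    show ?thesis
    proof (cases m)
      case (Chain y j)
      have "(i, p) \<in> strip_index X" "(j, q) \<in> strip_index X"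
        using ac t by (simp_all add: eq \<open>l = Chain x i\<close> Chain strip_index_def)
      then show ?thesis
        using g unfolding eq \<open>l = Chain x i\<close> Chain assemble_left(2)[OF t(2) x]
        by (cases "x = y") (simp_all add: mutually_inverse_def)
    qed (use Chain in \<open>simp_all add: eq assemble_left(2)[OF t(2) x]\<close>)
  next
    case (Sub x i)
    then have x: "x < t" using ac eq by simp
    show ?thesis
    proof (cases m)
      case (Sub y j)
      have "(\<Sum>b\<in>{b \<in> strip_index X'. (Suc (fst b), Suc x) \<in> R}. g (i, p) b * g' b (j, q)) =
        (\<Sum>b\<in>strip_index X'. g (i, p) b * g' b (j, q))" if "x = y"
      proof (rule sum.mono_neutral_left)
        have "g' b (j, q) = 0" if "(Suc (fst b), Suc x) \<notin> R" for b
          using order_supportedD[OF supp, of b "(j, q)"] ac \<open>x = y\<close> Sub that transD[OF trans]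
          by (fastforce simp: eq)
        then show "\<forall>b\<in>strip_index X' - {b \<in> strip_index X'. (Suc (fst b), Suc x) \<in> R}. g (i, p) b * g' b (j, q) = 0"
          by auto
      qed auto
      moreover have "(i, p) \<in> strip_index X" "(j, q) \<in> strip_index X"
        using ac t by (simp_all add: eq \<open>l = Sub x i\<close> Sub strip_index_def)
      ultimately show ?thesis
        using g unfolding eq \<open>l = Sub x i\<close> Sub assemble_left(3)[OF t(2) x]
        by (cases "x = y") (simp_all add: mutually_inverse_def)
    qed (use Sub in \<open>simp_all add: eq assemble_left(3)[OF t(2) x]\<close>)
  qed
qed

text \<open>The same \<open>g\<close> on all copies commutes with \<open>J\<close>. For
  \<open>N\<close>, the rows of \<open>Top\<close> give the representation equation, and at the
  embeddings transitivity keeps \<open>g\<close> inside each subspace.\<close>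

lemma assemble_intertwines:
  assumes R: "partial_order_on {1..t} R" and t: "0 < t" "length X = t" "length X' = t"
    and supp: "order_supported R g"
    and eq: "\<And>p b. p < dim_row (X!0) \<Longrightarrow> b \<in> strip_index X' \<Longrightarrow>
       (\<Sum>a\<in>strip_index X. X!fst a $$ (p, snd a) * g a b) =
       (\<Sum>r<dim_row (X'!0). H p r * X'!fst b $$ (r, snd b))"
  shows "intertwines t R X X' (assemble H g)"
  unfolding intertwines_def
proof (intro ballI conjI)
  have trans: "trans R" using R by (auto simp: partial_order_on_def preorder_on_def)
  fix a c assume ac: "a \<in> basis t R X" "c \<in> basis t R X'"
  obtain l p m q where lm: "a = (l, p)" "c = (m, q)" by (metis surj_pair)
  show "(\<Sum>b\<in>basis t R X. shift a b * assemble H g b c) = (\<Sum>b\<in>basis t R X'. assemble H g a b * shift b c)"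
  proof (cases l)
    case (Chain x i)
    then show ?thesis
      using ac unfolding lm by (cases x; cases m) (auto simp: shift_left shift_right)
  qed (use ac in \<open>cases m; auto simp: lm shift_left shift_right\<close>)+
  show "(\<Sum>b\<in>basis t R X. glue X a b * assemble H g b c) = (\<Sum>b\<in>basis t R X'. assemble H g a b * glue X' b c)"
  proof (cases l)
    case Top
    then show ?thesis
      using ac eq[of p "(_, q)"] t unfolding lm Top glue_left(1)[OF t(2,1)]
      by (cases m) (auto simp: glue_right strip_index_def)
  next
    case (Chain x i)
    show ?thesis
    proof (cases x)
      case 0
      then show ?thesis
        using ac Chain unfolding lm by (cases m) (auto simp: glue_left[OF t(2,1)] glue_right)
    next
      case (Suc x')
      have "(Suc i, Suc x') \<in> R" if "g (i, p) (j, q) \<noteq> 0" "(Suc j, Suc x') \<in> R" for j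
        using order_supportedD[OF supp that(1)] that(2) trans by (auto dest: transD)
      then show ?thesis
        using ac Chain Suc unfolding lm by (cases m) (auto simp: glue_left[OF t(2,1)] glue_right)
    qed
  next
    case (Sub x i)
    then show ?thesis
      using ac unfolding lm by (cases m) (auto simp: glue_left[OF t(2,1)] glue_right)
  qed
qed

section \<open>Similarity of pairs in terms of intertwiners\<close>

lemma similar_intertwine:
  fixes M :: "'a::comm_ring_1 mat"
  assumes c: "M \<in> carrier_mat n n" "M' \<in> carrier_mat n n" "S \<in> carrier_mat n n" "S' \<in> carrier_mat n n"
    and inv: "S * S' = 1\<^sub>m n" "S' * S = 1\<^sub>m n"
  shows "M' = S' * M * S \<longleftrightarrow> M * S = S * M'"
proof
  note assoc = assoc_mult_mat[of _ n n _ n _ n]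
  have "S * (S' * M * S) = S * S' * (M * S)" using c by (simp add: assoc)
  then show "M * S = S * M'" if "M' = S' * M * S" using that c inv by simp
  have "S' * M * S = S' * (M * S)" using c by (simp add: assoc)
  then have "S' * M * S = S' * S * M'" if "M * S = S * M'" using that c assoc[of S' S M'] by simp
  then show "M' = S' * M * S" if "M * S = S * M'" using that c inv by simp
qed

lemma pair_problem_iff:
  assumes "M \<in> carrier_mat n n" "N \<in> carrier_mat n n" "M' \<in> carrier_mat n' n'" "N' \<in> carrier_mat n' n'"
  shows "snd pair_problem [M, N] [M', N'] \<longleftrightarrow> n = n' \<and> (\<exists>S S'. S \<in> carrier_mat n n \<and> S' \<in> carrier_mat n n \<and>
    S * S' = 1\<^sub>m n \<and> S' * S = 1\<^sub>m n \<and> M * S = S * M' \<and> N * S = S * N')"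
proof
  assume "snd pair_problem [M, N] [M', N']"
  then obtain k S S' where k: "M \<in> carrier_mat k k" "S \<in> carrier_mat k k" "S' \<in> carrier_mat k k"
    "S * S' = 1\<^sub>m k" "S' * S = 1\<^sub>m k" "M' = S' * M * S" "N' = S' * N * S"
    by (auto simp: pair_problem_def)
  have n: "k = n" using k(1) assms(1) by auto
  have "dim_row M' = k" unfolding k(6) using k(1-3) by auto
  then have n': "n' = n" using assms(3) n by auto
  show "n = n' \<and> (\<exists>S S'. S \<in> carrier_mat n n \<and> S' \<in> carrier_mat n n \<and>
    S * S' = 1\<^sub>m n \<and> S' * S = 1\<^sub>m n \<and> M * S = S * M' \<and> N * S = S * N')"
    using k n n' assms similar_intertwine[of M n M' S S'] similar_intertwine[of N n N' S S'] by blast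
next
  assume "n = n' \<and> (\<exists>S S'. S \<in> carrier_mat n n \<and> S' \<in> carrier_mat n n \<and>
    S * S' = 1\<^sub>m n \<and> S' * S = 1\<^sub>m n \<and> M * S = S * M' \<and> N * S = S * N')"
  then obtain S S' where S: "n = n'" "S \<in> carrier_mat n n" "S' \<in> carrier_mat n n"
    "S * S' = 1\<^sub>m n" "S' * S = 1\<^sub>m n" "M * S = S * M'" "N * S = S * N'" by blast
  then have "M' = S' * M * S" "N' = S' * N * S"
    using assms similar_intertwine[of M n M' S S'] similar_intertwine[of N n N' S S'] by auto
  then show "snd pair_problem [M, N] [M', N']"
    unfolding pair_problem_def snd_conv using S(2-5) assms(1,2) by blast
qed

lemma pair_problem_refl:
  assumes "M \<in> carrier_mat n n" "N \<in> carrier_mat n n"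
  shows "snd pair_problem [M, N] [M, N]"
  unfolding pair_problem_iff[OF assms assms] using assms
  by (intro conjI refl exI[of _ "1\<^sub>m n"]) auto

lemma pair_problem_trans:
  assumes c: "M \<in> carrier_mat n n" "N \<in> carrier_mat n n" "M' \<in> carrier_mat n' n'" "N' \<in> carrier_mat n' n'"
      "M'' \<in> carrier_mat n'' n''" "N'' \<in> carrier_mat n'' n''"
    and 1: "snd pair_problem [M, N] [M', N']" and 2: "snd pair_problem [M', N'] [M'', N'']"
  shows "snd pair_problem [M, N] [M'', N'']"
proof -
  obtain S S' where S: "n = n'" "S \<in> carrier_mat n n" "S' \<in> carrier_mat n n"
    "S * S' = 1\<^sub>m n" "S' * S = 1\<^sub>m n" "M * S = S * M'" "N * S = S * N'"
    using 1 unfolding pair_problem_iff[OF c(1-4)] by blast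
  obtain T T' where T: "n' = n''" "T \<in> carrier_mat n' n'" "T' \<in> carrier_mat n' n'"
    "T * T' = 1\<^sub>m n'" "T' * T = 1\<^sub>m n'" "M' * T = T * M''" "N' * T = T * N''"
    using 2 unfolding pair_problem_iff[OF c(3-6)] by blast
  note T = T[folded S(1)] and c = c[folded S(1) T(1)[folded S(1)]]
  note assoc = assoc_mult_mat[of _ n n _ n _ n]
  have "S * T * (T' * S') = S * (T * T' * S')" using S(2,3) T(2,3) by (simp add: assoc)
  also have "\<dots> = 1\<^sub>m n" unfolding T(4) using S by simp
  finally have i1: "S * T * (T' * S') = 1\<^sub>m n" .
  have "T' * S' * (S * T) = T' * (S' * S * T)" using S(2,3) T(2,3) by (simp add: assoc)
  also have "\<dots> = 1\<^sub>m n" unfolding S(5) using T by simp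
  finally have i2: "T' * S' * (S * T) = 1\<^sub>m n" .
  have comp: "A * (S * T) = S * T * C" if "A * S = S * B" "B * T = T * C"
    "A \<in> carrier_mat n n" "B \<in> carrier_mat n n" "C \<in> carrier_mat n n" for A B C
  proof -
    have "A * (S * T) = A * S * T" using S(2) T(2) that(3-) by (simp add: assoc)
    also have "\<dots> = S * (B * T)" unfolding that(1) using S(2) T(2) that(3-) by (simp add: assoc)
    also have "\<dots> = S * T * C" unfolding that(2) using S(2) T(2) that(3-) by (simp add: assoc)
    finally show ?thesis .
  qed
  show ?thesis
    unfolding pair_problem_iff[OF c(1,2,5,6)]
  proof (intro conjI refl exI)
    show "S * T * (T' * S') = 1\<^sub>m n" "T' * S' * (S * T) = 1\<^sub>m n" by fact+
    show "M * (S * T) = S * T * M''" using comp S T c by blast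
    show "N * (S * T) = S * T * N''" using comp S T c by blast
  qed (use S T in auto)
qed

lemma set_block_index_labels:
  "set L = labels t R \<Longrightarrow> set (block_index L (label_dim X)) = basis t R X"
  by (simp add: set_block_index basis_def)

lemma poly_mat_val_eq:
  fixes X :: "'a::field mat list"
  assumes L: "distinct L" "set L = labels t R" and X: "length X = t" "0 < t"
  defines "xs \<equiv> block_index L (label_dim X)"
  shows "poly_mat_val L (label_dim X) entryP X =
      1\<^sub>m (length xs) + (fun_mat xs xs shift + fun_mat xs xs (glue X))"
    and "poly_mat_val L (label_dim X) entryQ X =
      1\<^sub>m (length xs) + (fun_mat xs xs shift + (fun_mat xs xs shift + fun_mat xs xs (glue X)) *
        (fun_mat xs xs shift + fun_mat xs xs (glue X)))"
proof -
  have d: "distinct xs" and s: "set xs = basis t R X"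
    using L by (simp_all add: xs_def distinct_block_index set_block_index_labels)
  show "poly_mat_val L (label_dim X) entryP X =
      1\<^sub>m (length xs) + (fun_mat xs xs shift + fun_mat xs xs (glue X))"
    unfolding fun_mat_one[OF d] fun_mat_add poly_mat_val_def xs_def[symmetric] fun_mat_eq_iff
    by (simp add: entryP_val)
  show "poly_mat_val L (label_dim X) entryQ X =
      1\<^sub>m (length xs) + (fun_mat xs xs shift + (fun_mat xs xs shift + fun_mat xs xs (glue X)) *
        (fun_mat xs xs shift + fun_mat xs xs (glue X)))"
    unfolding fun_mat_one[OF d] fun_mat_add fun_mat_mult[OF d] poly_mat_val_def xs_def[symmetric]
      fun_mat_eq_iff s
    using entryQ_val[OF X] by blast
qed

lemma poly_mat_val_carrier:
  "poly_mat_val L d T X \<in> carrier_mat (sum_list (map d L)) (sum_list (map d L))"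
  using fun_mat_carrier[of "block_index L d" "block_index L d"] by (simp add: poly_mat_val_def)

lemma fun_mat_intertwines:
  fixes X X' :: "'a::field mat list"
  assumes L: "distinct L" "set L = labels t R" and X: "length X = t" "length X' = t" "0 < t"
  defines "xs \<equiv> block_index L (label_dim X)" and "xs' \<equiv> block_index L (label_dim X')"
  assumes n: "length xs = n" "length xs' = n"
  shows "(poly_mat_val L (label_dim X) entryP X * fun_mat xs xs' F =
       fun_mat xs xs' F * poly_mat_val L (label_dim X') entryP X' \<and>
      poly_mat_val L (label_dim X) entryQ X * fun_mat xs xs' F =
       fun_mat xs xs' F * poly_mat_val L (label_dim X') entryQ X') \<longleftrightarrow> intertwines t R X X' F"
proof -
  have d: "distinct xs" "distinct xs'" and s: "set xs = basis t R X" "set xs' = basis t R X'"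
    using L by (simp_all add: xs_def xs'_def distinct_block_index set_block_index_labels)
  note vals = poly_mat_val_eq[OF L X(1,3), folded xs_def, unfolded n]
    poly_mat_val_eq[OF L X(2,3), folded xs'_def, unfolded n]
  have "?thesis \<longleftrightarrow> ((fun_mat xs xs shift * fun_mat xs xs' F = fun_mat xs xs' F * fun_mat xs' xs' shift \<and>
      fun_mat xs xs (glue X) * fun_mat xs xs' F = fun_mat xs xs' F * fun_mat xs' xs' (glue X')) \<longleftrightarrow>
    intertwines t R X X' F)"
    unfolding vals
    by (subst intertwine_iff) (simp_all add: carrier_matI fun_mat_def n)
  also have "\<dots>"
    unfolding fun_mat_mult[OF d(1)] fun_mat_mult[OF d(2)] fun_mat_eq_iff s intertwines_def by blast
  finally show ?thesis by simp
qed

lemma pair_problem_iff_rep_iso: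
  fixes X X' :: "'a::field mat list"
  assumes R: "partial_order_on {1..t} R" and L: "distinct L" "set L = labels t R"
    and X: "length X = t" "length X' = t" and t: "0 < t"
  shows "snd pair_problem
      [poly_mat_val L (label_dim X) entryP X, poly_mat_val L (label_dim X) entryQ X]
      [poly_mat_val L (label_dim X') entryP X', poly_mat_val L (label_dim X') entryQ X'] \<longleftrightarrow>
    rep_iso R X X'"
proof -
  define xs where "xs = block_index L (label_dim X)"
  define xs' where "xs' = block_index L (label_dim X')"
  define n where "n = length xs"
  have len: "length xs' = sum_list (map (label_dim X') L)" "n = sum_list (map (label_dim X) L)"
    by (simp_all add: xs'_def n_def xs_def)
  have d: "distinct xs" "distinct xs'" and s: "set xs = basis t R X" "set xs' = basis t R X'"
    using L by (simp_all add: xs_def xs'_def distinct_block_index set_block_index_labels)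
  note iff = pair_problem_iff[OF poly_mat_val_carrier poly_mat_val_carrier poly_mat_val_carrier
      poly_mat_val_carrier, of L "label_dim X" entryP X entryQ X L "label_dim X'" entryP X' entryQ X',
      folded len]
  show ?thesis
    unfolding iff
  proof
    assume "n = length xs' \<and> (\<exists>S S'. S \<in> carrier_mat n n \<and> S' \<in> carrier_mat n n \<and> S * S' = 1\<^sub>m n \<and> S' * S = 1\<^sub>m n \<and>
      poly_mat_val L (label_dim X) entryP X * S = S * poly_mat_val L (label_dim X') entryP X' \<and>
      poly_mat_val L (label_dim X) entryQ X * S = S * poly_mat_val L (label_dim X') entryQ X')"
    then obtain S S' where n: "length xs' = n" and S: "S \<in> carrier_mat n n" "S' \<in> carrier_mat n n"
      "S * S' = 1\<^sub>m n" "S' * S = 1\<^sub>m n"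
      "poly_mat_val L (label_dim X) entryP X * S = S * poly_mat_val L (label_dim X') entryP X'"
      "poly_mat_val L (label_dim X) entryQ X * S = S * poly_mat_val L (label_dim X') entryQ X'" by auto
    \<comment> \<open>Intertwining passes to the inverse with both pairs exchanged; this gives the
      relations needed for \<open>G\<close>.\<close>
    have inverse: "B * S' = S' * A" if "A * S = S * B" "A \<in> carrier_mat n n" "B \<in> carrier_mat n n" for A B
    proof -
      have "B = S' * A * S" using similar_intertwine[of A n B S S'] that S by blast
      then show ?thesis using similar_intertwine[of B n A S' S] that S
        by (metis assoc_mult_mat left_mult_one_mat mult_carrier_mat right_mult_one_mat)
    qed
    obtain F where F: "S = fun_mat xs xs' F"
      using fun_mat_exhaust[OF d, of S] S(1) n by (auto simp: n_def)
    obtain G where G: "S' = fun_mat xs' xs G"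
      using fun_mat_exhaust[OF d(2,1), of S'] S(2) n by (auto simp: n_def)
    have "mutually_inverse (basis t R X) (basis t R X') F G"
    proof -
      have one: "1\<^sub>m n = fun_mat xs xs (\<lambda>a b. of_bool (a = b) :: 'a)"
        "1\<^sub>m n = fun_mat xs' xs' (\<lambda>a b. of_bool (a = b) :: 'a)"
        using fun_mat_one[OF d(1)] fun_mat_one[OF d(2)] n unfolding n_def by metis+
      have "fun_mat xs xs' F * fun_mat xs' xs G = fun_mat xs xs (\<lambda>a b. of_bool (a = b))"
        "fun_mat xs' xs G * fun_mat xs xs' F = fun_mat xs' xs' (\<lambda>a b. of_bool (a = b))"
        using S(3,4) unfolding F G one[symmetric] by simp_all
      then show ?thesis
        unfolding fun_mat_mult[OF d(1)] fun_mat_mult[OF d(2)] fun_mat_eq_iff s mutually_inverse_def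
        by blast
    qed
    moreover have "intertwines t R X X' F"
      using fun_mat_intertwines[OF L X t, folded xs_def xs'_def, OF n_def[symmetric] n, of F] S(5,6)
      by (simp add: F)
    moreover have "intertwines t R X' X G"
    proof -
      have c: "poly_mat_val L (label_dim X) T X \<in> carrier_mat n n"
        "poly_mat_val L (label_dim X') T X' \<in> carrier_mat n n" for T
        using poly_mat_val_carrier[of L "label_dim X"] poly_mat_val_carrier[of L "label_dim X'"] len n
        by metis+
      show ?thesis
        using fun_mat_intertwines[OF L X(2,1) t, folded xs_def xs'_def, OF n n_def[symmetric], of G]
          inverse[OF S(5) c] inverse[OF S(6) c] unfolding G by blast
    qed
    ultimately show "rep_iso R X X'"
      by (intro rep_iso_of_intertwines[OF R t X])
  next
    assume "rep_iso R X X'"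
    then obtain H H' g g' where inv: "mutually_inverse {..<dim_row (X!0)} {..<dim_row (X'!0)} H H'"
      "mutually_inverse (strip_index X) (strip_index X') g g'"
      and supp: "order_supported R g" "order_supported R g'"
      and eq: "\<And>p b. p < dim_row (X!0) \<Longrightarrow> b \<in> strip_index X' \<Longrightarrow>
         (\<Sum>a\<in>strip_index X. X!fst a $$ (p, snd a) * g a b) =
         (\<Sum>r<dim_row (X'!0). H p r * X'!fst b $$ (r, snd b))"
      by (auto simp: rep_iso_def)
    \<comment> \<open>Isomorphic representations have equal block sizes, so both pairs consist of
      matrices of the same size.\<close>
    have "dim_row (X!0) = dim_row (X'!0)" by (rule mutually_inverse_eq[OF inv(1)])
    moreover have "dim_col (X!j) = dim_col (X'!j)" if "j < t" for j
      using mutually_inverse_eq[OF mutually_inverse_diag_block[OF R inv(2) supp]] that X by simp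
    ultimately have "label_dim X l = label_dim X' l" if "l \<in> labels t R" for l
      using that by (cases l) auto
    then have "map (label_dim X) L = map (label_dim X') L" using L by simp
    then have n: "length xs' = n" using len by metis
    let ?F = "assemble H g" and ?G = "assemble H' g'"
    have "fun_mat xs xs' ?F * fun_mat xs' xs ?G = fun_mat xs xs (\<lambda>a b. of_bool (a = b))"
      unfolding fun_mat_mult[OF d(2)] fun_mat_eq_iff s
      using assemble_half_inverse[OF R X inv supp(2)] by blast
    then have 1: "fun_mat xs xs' ?F * fun_mat xs' xs ?G = 1\<^sub>m n"
      by (simp add: n_def fun_mat_one[OF d(1)])
    have "fun_mat xs' xs ?G * fun_mat xs xs' ?F = fun_mat xs' xs' (\<lambda>a b. of_bool (a = b))"
      unfolding fun_mat_mult[OF d(1)] fun_mat_eq_iff s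
      using assemble_half_inverse[OF R X(2,1) inv[THEN mutually_inverse_sym] supp(1)] by blast
    then have 2: "fun_mat xs' xs ?G * fun_mat xs xs' ?F = 1\<^sub>m n"
      by (simp add: n[symmetric] fun_mat_one[OF d(2)])
    have "intertwines t R X X' ?F"
      by (rule assemble_intertwines[OF R t X supp(1) eq])
    then show "n = length xs' \<and> (\<exists>S S'. S \<in> carrier_mat n n \<and> S' \<in> carrier_mat n n \<and> S * S' = 1\<^sub>m n \<and> S' * S = 1\<^sub>m n \<and>
      poly_mat_val L (label_dim X) entryP X * S = S * poly_mat_val L (label_dim X') entryP X' \<and>
      poly_mat_val L (label_dim X) entryQ X * S = S * poly_mat_val L (label_dim X') entryQ X')"
      using fun_mat_intertwines[OF L X t, folded xs_def xs'_def, OF n_def[symmetric] n, of ?F] 1 2 n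
      by (intro conjI exI[of _ "fun_mat xs xs' ?F"] exI[of _ "fun_mat xs' xs ?G"])
        (auto simp: n_def fun_mat_def)
  qed
qed

section \<open>Existence and uniqueness of the substitution\<close>

lemma entry_ok_label_dim:
  assumes X: "X \<in> poset_reps t" and "a \<in> labels t R" "b \<in> labels t R"
  shows "entry_ok X (entryP a b) (label_dim X a) (label_dim X b)"
    and "entry_ok X (entryQ a b) (label_dim X a) (label_dim X b)"
proof -
  define m where "m = dim_row (X!0)"
  have len: "length X = t" using X by (simp add: poset_reps_iff)
  have m: "dim_row (X!j) = m" if "j < t" for j
    unfolding m_def by (rule poset_reps_dim_row[OF X]) (simp add: len that)
  show "entry_ok X (entryP a b) (label_dim X a) (label_dim X b)"
    using assms(2,3) m len by (cases a; cases b) (auto simp: m_def[symmetric])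
  show "entry_ok X (entryQ a b) (label_dim X a) (label_dim X b)"
    using assms(2,3) m len by (cases a; cases b) (auto simp: m_def[symmetric])
qed

text \<open>
  A diagonal entry 1 makes the height and the width of a block agree; the other entries 1 connect all
  blocks of a strip with each other, and one entry \<open>Var i\<close> ties them to the sizes of the given matrices.
\<close>

lemma label_dim_unique:
  assumes X: "X \<in> poset_reps t" and t: "0 < t"
    and diag: "\<And>a. T a a = One"
    and succ: "\<And>x i. T (Chain (Suc x) i) (Chain x i) = One"
    and top: "y < t + 2" "\<And>i. T Top (Chain y i) = Var i"
    and sub: "\<And>x. x < t \<Longrightarrow> z x < t + 2" "\<And>x i. T (Chain (z x) i) (Sub x i) = One"
    and ok: "\<And>a b. a \<in> labels t R \<Longrightarrow> b \<in> labels t R \<Longrightarrow> entry_ok X (T a b) (h a) (w b)"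
    and a: "a \<in> labels t R"
  shows "h a = label_dim X a \<and> w a = label_dim X a"
proof -
  have hw: "h b = w b" if "b \<in> labels t R" for b
    using ok[OF that that] by (simp add: diag)
  have step: "h (Chain (Suc x) i) = w (Chain x i)" if "Suc x < t + 2" "i < t" for x i
    using ok[of "Chain (Suc x) i" "Chain x i"] that by (simp add: succ)
  have const: "w (Chain x i) = w (Chain 0 i)" if "x < t + 2" "i < t" for x i
    using that
  proof (induction x)
    case (Suc x)
    then show ?case using step[of x i] hw[of "Chain (Suc x) i"] by simp
  qed simp
  have Top: "dim_row (X!i) = h Top" "dim_col (X!i) = w (Chain y i)" if "i < t" for i
    using ok[of Top "Chain y i"] that top by simp_all
  have chain: "w (Chain x i) = dim_col (X!i)" if "x < t + 2" "i < t" for x i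
    using const[OF that] const[OF top(1) that(2)] Top(2)[OF that(2)] by simp
  show ?thesis
  proof (cases a)
    case Top
    then show ?thesis using \<open>\<And>i. i < t \<Longrightarrow> dim_row (X!i) = h Top\<close>[OF t] hw[of Top] by simp
  next
    case (Chain x i)
    then show ?thesis using a hw[of a] chain[of x i] by simp
  next
    case (Sub x i)
    then have "h (Chain (z x) i) = w (Sub x i)"
      using ok[of "Chain (z x) i" "Sub x i"] sub a by simp
    then show ?thesis
      using Sub a hw[of a] hw[of "Chain (z x) i"] chain[of "z x" i] sub(1)[of x] by simp
  qed
qed

text \<open>The substitution has exactly one outcome, so the quantifiers over outcomes in
  \<open>contains\<close> collapse to a single pair for each \<open>X\<close>.\<close>

lemma subst_tuple_iff:
  fixes X :: "'a::field mat list"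
  assumes L: "distinct L" "set L = labels t R" and X: "X \<in> poset_reps t" and t: "0 < t"
  shows "subst_tuple [poly_mat L entryP, poly_mat L entryQ] X Ms \<longleftrightarrow>
    Ms = [poly_mat_val L (label_dim X) entryP X, poly_mat_val L (label_dim X) entryQ X]"
proof -
  have diag: "entryP a a = One" "entryQ a a = One" for a by (cases a; simp)+
  have P: "subst_mat (poly_mat L entryP) X M \<longleftrightarrow> M = poly_mat_val L (label_dim X) entryP X" for M
  proof
    assume "subst_mat (poly_mat L entryP) X M"
    then show "M = poly_mat_val L (label_dim X) entryP X"
    proof (rule subst_mat_poly_mat_unique[OF L(1), rotated])
      fix h w a assume "\<And>a b. a \<in> set L \<Longrightarrow> b \<in> set L \<Longrightarrow> entry_ok X (entryP a b) (h a) (w b)" "a \<in> set L"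
      then show "h a = label_dim X a \<and> w a = label_dim X a"
        \<comment> \<open>In \<open>entryP\<close> the variables stand in the columns of copy 1, and
          subspace \<open>x\<close> is tied to copy \<open>x + 1\<close>.\<close>
        unfolding L(2) by (intro label_dim_unique[OF X t, of entryP 1 Suc]) (auto simp: diag)
    qed
  qed (use subst_mat_poly_mat_val[of L X entryP "label_dim X"] entry_ok_label_dim[OF X] L in auto)
  have Q: "subst_mat (poly_mat L entryQ) X M \<longleftrightarrow> M = poly_mat_val L (label_dim X) entryQ X" for M
  proof
    assume "subst_mat (poly_mat L entryQ) X M"
    then show "M = poly_mat_val L (label_dim X) entryQ X"
    proof (rule subst_mat_poly_mat_unique[OF L(1), rotated])
      fix h w a assume "\<And>a b. a \<in> set L \<Longrightarrow> b \<in> set L \<Longrightarrow> entry_ok X (entryQ a b) (h a) (w b)" "a \<in> set L"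
      then show "h a = label_dim X a \<and> w a = label_dim X a"
        \<comment> \<open>In \<open>entryQ\<close> the variables stand in the columns of copy 0, and
          subspace \<open>x\<close> is tied to copy \<open>x + 2\<close>, which exists since
          \<open>x < t\<close>.\<close>
        unfolding L(2)
        by (intro label_dim_unique[OF X t, of entryQ 0 "\<lambda>x. Suc (Suc x)"]) (auto simp: diag)
    qed
  qed (use subst_mat_poly_mat_val[of L X entryQ "label_dim X"] entry_ok_label_dim[OF X] L in auto)
  show ?thesis
  proof
    assume *: "subst_tuple [poly_mat L entryP, poly_mat L entryQ] X Ms"
    then obtain M N where "Ms = [M, N]"
      by (auto simp: subst_tuple_def length_Suc_conv)
    with * show "Ms = [poly_mat_val L (label_dim X) entryP X, poly_mat_val L (label_dim X) entryQ X]"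
      using P Q by (auto simp: subst_tuple_def less_Suc_eq all_conj_distrib)
  qed (auto simp: subst_tuple_def less_Suc_eq P Q)
qed

text \<open>Without strips there is no first block to supply a number of rows, and \<open>[]\<close>
  is the only representation. It is sent to a pair of matrices of size 0, any two of which are
  equal.\<close>

lemma contains_poset_problem_empty:
  "contains (pair_problem :: 'a::field matrix_problem) (poset_problem 0 R)"
proof -
  let ?T = "(0, 0, \<lambda>r s w. 0) :: 'a ncpoly_mat"
  have T: "subst_mat ?T X M \<longleftrightarrow> M \<in> carrier_mat 0 0" for X M
    by (simp add: subst_mat_def)
  have reps: "poset_reps 0 = {[] :: 'a mat list}" by (auto simp: poset_reps_def)
  have subst: "subst_tuple [?T, ?T] X Ms \<longleftrightarrow> (\<exists>M N. Ms = [M, N] \<and> M \<in> carrier_mat 0 0 \<and> N \<in> carrier_mat 0 0)"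
    for X Ms
    by (auto simp: subst_tuple_def T less_Suc_eq length_Suc_conv all_conj_distrib)
  have pair: "snd pair_problem [M, N] [M', N']"
    if "M \<in> carrier_mat 0 0" "N \<in> carrier_mat 0 0" "M' \<in> carrier_mat 0 0" "N' \<in> carrier_mat 0 0"
    for M N M' N' :: "'a mat"
  proof -
    have "M' = M" "N' = N" using that by (auto intro!: eq_matI)
    then show ?thesis using pair_problem_refl that by blast
  qed
  show ?thesis
    unfolding contains_def
  proof (intro exI[of _ "[?T, ?T]"] conjI ballI allI impI)
    fix X X' :: "'a mat list" and Ms Ms'
    assume "X \<in> fst (poset_problem 0 R)" "X' \<in> fst (poset_problem 0 R)"
      "subst_tuple [?T, ?T] X Ms" "subst_tuple [?T, ?T] X' Ms'"
    then show "snd (poset_problem 0 R) X X' \<longleftrightarrow> snd pair_problem Ms Ms'"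
      using pair by (auto simp: poset_problem_def reps subst)
  next
    show "\<exists>Ms. subst_tuple [?T, ?T] X Ms" for X
      unfolding subst by (rule exI[of _ "[0\<^sub>m 0 0, 0\<^sub>m 0 0]"]) simp
  qed (auto simp: is_ncpoly_mat_def subst pair_problem_def)
qed

theorem theorem3p2:
  fixes t :: nat and R :: "(nat \<times> nat) set"
  assumes "partial_order_on {1..t} R"
  shows "contains (pair_problem :: 'a::field matrix_problem) (poset_problem t R)"
proof (cases "t = 0")
  case True
  then show ?thesis by (simp add: contains_poset_problem_empty)
next
  case False
  then have t: "0 < t" by simp
  obtain L where L: "distinct L" "set L = labels t R"
    using finite_distinct_list[OF finite_labels] by blast
  let ?Ms = "\<lambda>X :: 'a mat list.
    [poly_mat_val L (label_dim X) entryP X, poly_mat_val L (label_dim X) entryQ X]"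
  note subst = subst_tuple_iff[OF L _ t]
  have iso: "snd pair_problem (?Ms X) (?Ms X') \<longleftrightarrow> rep_iso R X X'"
    if "X \<in> poset_reps t" "X' \<in> poset_reps t" for X X' :: "'a mat list"
    using that by (intro pair_problem_iff_rep_iso[OF assms L _ _ t]) (auto simp: poset_reps_iff)
  \<comment> \<open>A single step becomes an isomorphism and then a similarity. Sequences of steps
    are composed on the side of pairs, where transitivity is multiplication of the matrices
    \<open>S\<close>.\<close>
  have steps: "snd pair_problem (?Ms X) (?Ms X')"
    if "(poset_step t R)\<^sup>*\<^sup>* X X'" for X X' :: "'a mat list"
    using that
  proof (induction rule: rtranclp_induct)
    case base
    show ?case by (rule pair_problem_refl poly_mat_val_carrier)+
  next
    case (step Y Z)
    have "snd pair_problem (?Ms Y) (?Ms Z)"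
      using iso poset_step_reps[OF step.hyps(2)] step_imp_rep_iso[OF assms t step.hyps(2)] by blast
    then show ?case
      by (rule pair_problem_trans[OF poly_mat_val_carrier poly_mat_val_carrier poly_mat_val_carrier
            poly_mat_val_carrier poly_mat_val_carrier poly_mat_val_carrier step.IH])
  qed
  show ?thesis
    unfolding contains_def poset_problem_def fst_conv snd_conv
  proof (intro exI[of _ "[poly_mat L entryP, poly_mat L entryQ]"] conjI ballI allI impI)
    fix X X' :: "'a mat list" and Ms Ms'
    assume X: "X \<in> poset_reps t" "X' \<in> poset_reps t"
      and Ms: "subst_tuple [poly_mat L entryP, poly_mat L entryQ] X Ms"
        "subst_tuple [poly_mat L entryP, poly_mat L entryQ] X' Ms'"
    then have "Ms = ?Ms X" "Ms' = ?Ms X'" using subst by blast+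
    then show "(poset_step t R)\<^sup>*\<^sup>* X X' \<longleftrightarrow> snd pair_problem Ms Ms'"
      using steps iso[OF X] rep_iso_imp_steps[OF assms t X] by blast
  next
    fix X :: "'a mat list" and Ms
    assume "X \<in> poset_reps t" "subst_tuple [poly_mat L entryP, poly_mat L entryQ] X Ms"
    then have "Ms = ?Ms X" using subst by blast
    then show "Ms \<in> fst pair_problem"
      using poly_mat_val_carrier unfolding pair_problem_def fst_conv by blast
  qed (auto simp: subst is_ncpoly_mat_poly_mat)
qed

end
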